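(* There exists a countable, finitely branching and acyclic MDP $\mathcal{M}$ with integer transition rewards and initial state $s_0$, whose step counter is implicit in the state, such that the value of $s_0$ for the objective $\mathit{MP}_{\liminf\ge 0}=\{\rho\mid \liminf_{n\to\infty}\frac1n\sum_{j=0}^{n-1} r(e_j)\ge 0\}$ is $1$, while every finite-memory randomized (FR) strategy $\sigma$ satisfies $\mathcal{P}_{\mathcal{M},s_0,\sigma}(\mathit{MP}_{\liminf\ge 0})=0$. In particular, for every $k\in\mathbb{N}$ and every $\varepsilon<1$ there are no $\varepsilon$-optimal $k$-bit Markov strategies for $\mathit{MP}_{\liminf\ge 0}$ in countable MDPs.
   Context: An MDP has a countable set of states partitioned into controlled and random states, a transition relation (every state has a successor), fixed probability distributions over successors at random states, and real rewards on transitions; runs are $s_0e_0s_1e_1\dots$ with transitions $e_j$. It is finitely branching if each state has finitely many successors and acyclic if its transition graph has no directed cycle. The step counter is implicit in the state if for every state $s$ all finite paths from $s_0$ to $s$ have the same length. A strategy assigns to each finite partial run ending in a controlled state a distribution over successors, inducing a probability measure $\mathcal{P}_{\mathcal{M},s_0,\sigma}$ on runs; the value is the supremum of the objective's probability over all strategies, and $\varepsilon$-optimal means attaining at least value$-\varepsilon$. FR strategies are those implementable with a finite set of memory modes and (possibly randomized) memory updates and choices depending on the current mode and state. A $k$-bit Markov strategy bases its choices on the current state, the number of steps taken so far, and $k$ bits of general-purpose memory. *)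

theory Defs
  imports "HOL-Probability.Probability"
begin

section \<open>Markov decision processes\<close>

text \<open>A transition is identified with its pair of end points, so partial runs are lists of states and
  runs are sequences of states.\<close>

record 's mdp =
  controlled :: "'s set"
  random :: "'s set"
  transitions :: "('s \<times> 's) set"
  trans_prob :: "'s \<Rightarrow> 's pmf"
  reward :: "'s \<times> 's \<Rightarrow> real"

definition states :: "'s mdp \<Rightarrow> 's set" where
  "states M = controlled M \<union> random M"

definition succs :: "'s mdp \<Rightarrow> 's \<Rightarrow> 's set" where
  "succs M s = transitions M `` {s}"

definition is_mdp :: "'s mdp \<Rightarrow> bool" where
  "is_mdp M \<longleftrightarrow>
     countable (states M) \<and>
     controlled M \<inter> random M = {} \<and>
     transitions M \<subseteq> states M \<times> states M \<and>
     (\<forall>s \<in> states M. succs M s \<noteq> {}) \<and>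
     (\<forall>s \<in> random M. set_pmf (trans_prob M s) \<subseteq> succs M s)"

definition finitely_branching :: "'s mdp \<Rightarrow> bool" where
  "finitely_branching M \<longleftrightarrow> (\<forall>s \<in> states M. finite (succs M s))"

definition integer_rewards :: "'s mdp \<Rightarrow> bool" where
  "integer_rewards M \<longleftrightarrow> (\<forall>e \<in> transitions M. reward M e \<in> \<int>)"

definition partial_runs :: "'s mdp \<Rightarrow> 's \<Rightarrow> 's list set" where
  "partial_runs M s0 = {h. h \<noteq> [] \<and> hd h = s0 \<and> successively (\<lambda>s t. (s, t) \<in> transitions M) h}"

definition runs :: "'s mdp \<Rightarrow> 's \<Rightarrow> (nat \<Rightarrow> 's) set" where
  "runs M s0 = {\<rho>. \<rho> 0 = s0 \<and> (\<forall>i. (\<rho> i, \<rho> (Suc i)) \<in> transitions M)}"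

definition step_counter_implicit :: "'s mdp \<Rightarrow> 's \<Rightarrow> bool" where
  "step_counter_implicit M s0 \<longleftrightarrow>
     (\<forall>h \<in> partial_runs M s0. \<forall>h' \<in> partial_runs M s0. last h = last h' \<longrightarrow> length h = length h')"

section \<open>Strategies and the induced probability measure on runs\<close>

text \<open>Only the values of a strategy on partial runs from the initial state that end in a controlled
  state matter; elsewhere the function is unconstrained.\<close>

definition strategies :: "'s mdp \<Rightarrow> 's \<Rightarrow> ('s list \<Rightarrow> 's pmf) set" where
  "strategies M s0 =
     {\<sigma>. \<forall>h \<in> partial_runs M s0. last h \<in> controlled M \<longrightarrow> set_pmf (\<sigma> h) \<subseteq> succs M (last h)}"

definition next_state :: "'s mdp \<Rightarrow> ('s list \<Rightarrow> 's pmf) \<Rightarrow> 's list \<Rightarrow> 's pmf" where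
  "next_state M \<sigma> h = (if last h \<in> controlled M then \<sigma> h else trans_prob M (last h))"

definition run_kernel ::
  "'s mdp \<Rightarrow> 's \<Rightarrow> ('s list \<Rightarrow> 's pmf) \<Rightarrow> nat \<Rightarrow> (nat \<Rightarrow> 's) \<Rightarrow> 's measure" where
  "run_kernel M s0 \<sigma> n \<rho> =
     measure_pmf (if n = 0 then return_pmf s0 else next_state M \<sigma> (map \<rho> [0..<n]))"

text \<open>The Ionescu-Tulcea extension of the one-step kernels to the product \<open>\<sigma>\<close>-algebra on
  infinite state sequences. The sort constraint \<open>countable\<close> makes the kernels measurable, see
  \<open>Ionescu_Tulcea_run_kernel\<close> and the cylinder probabilities below.\<close>

definition run_measure ::
  "('s :: countable) mdp \<Rightarrow> 's \<Rightarrow> ('s list \<Rightarrow> 's pmf) \<Rightarrow> (nat \<Rightarrow> 's) measure" where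
  "run_measure M s0 \<sigma> =
     projective_family.lim UNIV
       (Ionescu_Tulcea.CI (run_kernel M s0 \<sigma>) (\<lambda>_. count_space UNIV)) (\<lambda>_. count_space UNIV)"

lemma Ionescu_Tulcea_run_kernel:
  "Ionescu_Tulcea (run_kernel M s0 \<sigma>) (\<lambda>_. count_space (UNIV :: 's :: countable set))"
proof (rule Ionescu_Tulcea.intro)
  fix n :: nat
  have "PiM {0..<n} (\<lambda>_. count_space (UNIV :: 's set)) = count_space (PiE {0..<n} (\<lambda>_. UNIV))"
    by (rule count_space_PiM_finite) auto
  then show "run_kernel M s0 \<sigma> n \<in>
      measurable (PiM {0..<n} (\<lambda>_. count_space UNIV)) (subprob_algebra (count_space UNIV))"
    by (auto simp: run_kernel_def measure_pmf_in_subprob_algebra)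
qed (simp add: run_kernel_def measure_pmf.prob_space_axioms)

lemma sets_run_measure:
  "sets (run_measure M s0 \<sigma>) = sets (PiM UNIV (\<lambda>_. count_space UNIV))"
proof -
  interpret Ionescu_Tulcea "run_kernel M s0 \<sigma>" "\<lambda>_. count_space UNIV"
    by (rule Ionescu_Tulcea_run_kernel)
  show ?thesis by (simp add: run_measure_def)
qed

definition cylinder :: "'s list \<Rightarrow> (nat \<Rightarrow> 's) set" where
  "cylinder h = {\<rho>. map \<rho> [0..<length h] = h}"

lemma prob_space_run_measure: "prob_space (run_measure M s0 \<sigma>)"
proof -
  interpret Ionescu_Tulcea "run_kernel M s0 \<sigma>" "\<lambda>_. count_space UNIV"
    by (rule Ionescu_Tulcea_run_kernel)
  have "emeasure PF.lim (PF.emb UNIV {} {\<lambda>x. undefined}) = emeasure (CI {}) {\<lambda>x. undefined}"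
    by (rule lim) (auto simp: PiM_empty)
  also have "\<dots> = 1"
    using prob_space.emeasure_space_1[OF PF.prob_space_P[of "{}"]] PF.sets_P[of "{}"]
    by (metis PF.space_P finite.emptyI empty_subsetI space_PiM_empty)
  also have "PF.emb UNIV {} {\<lambda>x. undefined} = space PF.lim"
    by (auto simp: prod_emb_def space_PiM PF.space_lim)
  finally show ?thesis unfolding run_measure_def by (rule prob_spaceI)
qed

lemma emeasure_cylinder_step:
  fixes M :: "('s :: countable) mdp"
  shows "emeasure (run_measure M s0 \<sigma>) (cylinder (h @ [s])) =
    emeasure (run_measure M s0 \<sigma>) (cylinder h) *
    emeasure (run_kernel M s0 \<sigma> (length h) (\<lambda>i. h ! i)) {s}"
proof -
  let ?N = "\<lambda>_ :: nat. count_space (UNIV :: 's set)"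
  interpret Ionescu_Tulcea "run_kernel M s0 \<sigma>" ?N
    by (rule Ionescu_Tulcea_run_kernel)
  define n where "n = length h"
  define r :: "'s list \<Rightarrow> nat \<Rightarrow> 's" where "r g = restrict (\<lambda>i. g ! i) {0..<length g}" for g
  have PiM_eq: "PiM {0..<k} ?N = count_space (PiE {0..<k} (\<lambda>_. UNIV))" for k :: nat
    by (rule count_space_PiM_finite) auto
  have r_in: "r g \<in> PiE {0..<length g} (\<lambda>_. UNIV)" for g
    by (auto simp: r_def)
  have sets_r: "{r g} \<in> sets (PiM {0..<length g} ?N)" for g
    using r_in[of g] by (simp add: PiM_eq)
  have restr: "restrict x A = restrict y A \<longleftrightarrow> (\<forall>i \<in> A. x i = y i)" for x y :: "nat \<Rightarrow> 's" and A
    by (auto simp: restrict_def fun_eq_iff)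
  have cyl: "emeasure (run_measure M s0 \<sigma>) (cylinder g) = emeasure (C 0 (length g) (\<lambda>_. undefined)) {r g}"
    for g
  proof -
    have "x \<in> cylinder g \<longleftrightarrow> restrict x {0..<length g} = r g" for x
      unfolding cylinder_def r_def mem_Collect_eq restr by (subst list_eq_iff_nth_eq) auto
    then have "cylinder g = PF.emb UNIV {0..<length g} {r g}"
      by (simp add: prod_emb_def set_eq_iff PiE_iff)
    then have "emeasure (run_measure M s0 \<sigma>) (cylinder g) = emeasure (CI {0..<length g}) {r g}"
      unfolding run_measure_def using lim[OF _ sets_r, of g] by simp
    also have "\<dots> = emeasure (C 0 (length g) (\<lambda>_. undefined)) (PF.emb {0..<length g} {0..<length g} {r g})"
      by (rule emeasure_CI[OF order_refl sets_r])
    also have "PF.emb {0..<length g} {0..<length g} {r g} = {r g}"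
      using sets.sets_into_space[OF sets_r] by (intro prod_emb_id) (simp add: space_PiM)
    finally show ?thesis .
  qed
  have u_in: "(\<lambda>_. undefined) \<in> space (PiM {0..<0} ?N)" by (simp add: space_PiM)
  have upd: "(x(n := a) = r (h @ [s])) \<longleftrightarrow> x = r h \<and> a = s"
    if "x \<in> space (PiM {0..<n} ?N)" for x a
  proof -
    have "x i = undefined" if "i \<ge> n" for i
      using \<open>x \<in> _\<close> that by (auto simp: space_PiM PiE_iff extensional_def)
    then show ?thesis
      unfolding r_def n_def[symmetric] fun_eq_iff restrict_def
      by (auto simp: nth_append n_def less_Suc_eq split: if_splits)
  qed
  have eP_eq: "emeasure (eP n x) {r (h @ [s])} =
      emeasure (run_kernel M s0 \<sigma> n (r h)) {s} * indicator {r h} x"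
    if "x \<in> space (PiM {0..<n} ?N)" for x
  proof -
    have "emeasure (eP n x) {r (h @ [s])} =
        emeasure (run_kernel M s0 \<sigma> n x) ((\<lambda>a. x(n := a)) -` {r (h @ [s])} \<inter> space (?N n))"
      using sets_r[of "h @ [s]"] that by (intro emeasure_eP) (auto simp: n_def)
    also have "(\<lambda>a. x(n := a)) -` {r (h @ [s])} \<inter> space (?N n) = (if x = r h then {s} else {})"
      using upd[OF that] by auto
    finally show ?thesis by simp
  qed
  have "emeasure (C 0 (Suc n) (\<lambda>_. undefined)) {r (h @ [s])} =
      (\<integral>\<^sup>+x. emeasure (eP n x) {r (h @ [s])} \<partial>C 0 n (\<lambda>_. undefined))"
    unfolding C.simps add_0
  proof (rule emeasure_bind[where N = "PiM {0..<Suc n} ?N"])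
    show "space (C 0 n (\<lambda>_. undefined)) \<noteq> {}"
      using prob_space.not_empty[OF prob_space_C[OF u_in]] .
    show "eP n \<in> measurable (C 0 n (\<lambda>_. undefined)) (subprob_algebra (PiM {0..<Suc n} ?N))"
      by (subst measurable_cong_sets[OF sets_C[OF u_in, unfolded add_0] refl]) (rule measurable_eP)
    show "{r (h @ [s])} \<in> sets (PiM {0..<Suc n} ?N)"
      using sets_r[of "h @ [s]"] by (simp add: n_def)
  qed
  also have "\<dots> = (\<integral>\<^sup>+x. emeasure (run_kernel M s0 \<sigma> n (r h)) {s} * indicator {r h} x
      \<partial>C 0 n (\<lambda>_. undefined))"
    using space_C[OF u_in, of n] by (intro nn_integral_cong eP_eq) simp
  also have "\<dots> = emeasure (run_kernel M s0 \<sigma> n (r h)) {s} * emeasure (C 0 n (\<lambda>_. undefined)) {r h}"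
    using sets_r[of h] by (intro nn_integral_cmult_indicator) (simp add: sets_C[OF u_in] n_def)
  finally have main: "emeasure (C 0 (Suc n) (\<lambda>_. undefined)) {r (h @ [s])} = \<dots>" .
  have "map (r h) [0..<n] = map (\<lambda>i. h ! i) [0..<n]"
    by (rule map_cong) (auto simp: r_def n_def)
  then have "run_kernel M s0 \<sigma> n (r h) = run_kernel M s0 \<sigma> n (\<lambda>i. h ! i)"
    unfolding run_kernel_def by (simp only:)
  then show ?thesis
    using main by (simp add: cyl n_def[symmetric] mult.commute)
qed

lemma emeasure_cylinder_singleton:
  "emeasure (run_measure M s0 \<sigma>) (cylinder [s]) = (if s = s0 then 1 else 0)"
proof -
  have "cylinder [] = space (run_measure M s0 \<sigma>)"
    using sets_eq_imp_space_eq[OF sets_run_measure[of M s0 \<sigma>]]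
    by (simp add: cylinder_def space_PiM)
  then have "emeasure (run_measure M s0 \<sigma>) (cylinder []) = 1"
    using prob_space.emeasure_space_1[OF prob_space_run_measure] by metis
  then show ?thesis
    using emeasure_cylinder_step[of M s0 \<sigma> "[]" s]
    by (simp add: run_kernel_def emeasure_pmf_single)
qed

lemma emeasure_cylinder_snoc:
  assumes "h \<noteq> []"
  shows "emeasure (run_measure M s0 \<sigma>) (cylinder (h @ [s])) =
    emeasure (run_measure M s0 \<sigma>) (cylinder h) * pmf (next_state M \<sigma> h) s"
  using emeasure_cylinder_step[of M s0 \<sigma> h s] assms
  by (simp add: run_kernel_def emeasure_pmf_single map_nth)

section \<open>Objective, value and optimality\<close>

definition mean_payoff :: "'s mdp \<Rightarrow> (nat \<Rightarrow> 's) \<Rightarrow> nat \<Rightarrow> real" where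
  "mean_payoff M \<rho> n = (\<Sum>j<n. reward M (\<rho> j, \<rho> (Suc j))) / real n"

definition MP_liminf_nonneg :: "'s mdp \<Rightarrow> 's \<Rightarrow> (nat \<Rightarrow> 's) set" where
  "MP_liminf_nonneg M s0 = {\<rho> \<in> runs M s0. liminf (\<lambda>n. ereal (mean_payoff M \<rho> n)) \<ge> 0}"

lemma sets_MP_liminf_nonneg:
  fixes M :: "('s :: countable) mdp"
  shows "MP_liminf_nonneg M s0 \<in> sets (run_measure M s0 \<sigma>)"
proof -
  let ?P = "PiM UNIV (\<lambda>_ :: nat. count_space (UNIV :: 's set))"
  have pair: "(\<lambda>\<rho>. f (\<rho> i) (\<rho> j)) \<in> measurable ?P N"
    if "\<And>a b. f a b \<in> space N" for f :: "'s \<Rightarrow> 's \<Rightarrow> 'b" and N i j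
  proof -
    have "(\<lambda>\<rho>. f (\<rho> i) b) \<in> measurable ?P N" for b
      using measurable_compose[OF measurable_component_singleton[of i UNIV "\<lambda>_. count_space UNIV"],
          of "\<lambda>a. f a b" N] that by simp
    then show ?thesis
      by (rule measurable_compose_countable) (rule measurable_component_singleton, simp)
  qed
  have [measurable]: "(\<lambda>\<rho>. reward M (\<rho> i, \<rho> j)) \<in> borel_measurable ?P" for i j
    by (rule pair) simp
  have [measurable]: "Measurable.pred ?P (\<lambda>\<rho>. (\<rho> i, \<rho> j) \<in> transitions M)" for i j
    by (rule pair) simp
  have [measurable]: "Measurable.pred ?P (\<lambda>\<rho>. \<rho> 0 = s0)"
    by (rule pair[of "\<lambda>a b. a = s0" _ 0 0]) simp
  have "{\<rho> \<in> space ?P. (\<rho> 0 = s0 \<and> (\<forall>i. (\<rho> i, \<rho> (Suc i)) \<in> transitions M)) \<and>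
      liminf (\<lambda>n. ereal (mean_payoff M \<rho> n)) \<ge> 0} \<in> sets ?P"
    unfolding mean_payoff_def by measurable
  then show ?thesis
    by (simp add: sets_run_measure MP_liminf_nonneg_def runs_def space_PiM)
qed

definition prob_of ::
  "('s :: countable) mdp \<Rightarrow> 's \<Rightarrow> ('s list \<Rightarrow> 's pmf) \<Rightarrow> (nat \<Rightarrow> 's) set \<Rightarrow> real" where
  "prob_of M s0 \<sigma> A = measure (run_measure M s0 \<sigma>) A"

definition mdp_value :: "('s :: countable) mdp \<Rightarrow> 's \<Rightarrow> (nat \<Rightarrow> 's) set \<Rightarrow> real" where
  "mdp_value M s0 A = (SUP \<sigma> \<in> strategies M s0. prob_of M s0 \<sigma> A)"

definition eps_optimal ::
  "('s :: countable) mdp \<Rightarrow> 's \<Rightarrow> (nat \<Rightarrow> 's) set \<Rightarrow> real \<Rightarrow> ('s list \<Rightarrow> 's pmf) \<Rightarrow> bool" where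
  "eps_optimal M s0 A \<epsilon> \<sigma> \<longleftrightarrow> \<sigma> \<in> strategies M s0 \<and> prob_of M s0 \<sigma> A \<ge> mdp_value M s0 A - \<epsilon>"

section \<open>Memory-based strategies\<close>

text \<open>An update function jointly draws the next memory mode and the next state. At random states it
  may only choose the memory mode: the state marginal is the one prescribed by the MDP.\<close>

definition update_function ::
  "'s mdp \<Rightarrow> 'm set \<Rightarrow> ('m \<times> 's \<Rightarrow> ('m \<times> 's) pmf) \<Rightarrow> bool" where
  "update_function M Mem u \<longleftrightarrow>
     (\<forall>m \<in> Mem. \<forall>s \<in> controlled M. set_pmf (u (m, s)) \<subseteq> Mem \<times> succs M s) \<and>
     (\<forall>m \<in> Mem. \<forall>s \<in> random M.
        set_pmf (u (m, s)) \<subseteq> Mem \<times> UNIV \<and> map_pmf snd (u (m, s)) = trans_prob M s)"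

text \<open>Distribution of the first \<open>n\<close> steps of the Markov chain on \<open>Mem \<times> S\<close> with transition
  probabilities \<open>u\<close>.\<close>

fun chain_prefix :: "('m \<times> 's \<Rightarrow> ('m \<times> 's) pmf) \<Rightarrow> 'm \<times> 's \<Rightarrow> nat \<Rightarrow> ('m \<times> 's) list pmf" where
  "chain_prefix u x 0 = return_pmf [x]"
| "chain_prefix u x (Suc n) =
     bind_pmf (chain_prefix u x n) (\<lambda>w. map_pmf (\<lambda>y. w @ [y]) (u (last w)))"

definition lifts :: "'s list \<Rightarrow> ('m \<times> 's) list set" where
  "lifts h = {w. map snd w = h}"

text \<open>The strategy \<open>u[m0]\<close>: after the partial run \<open>h\<close> the current mode is distributed as in the
  chain conditioned on its state component having followed \<open>h\<close>; then one draw of \<open>u\<close> is made and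
  its state component is used. The conditional distribution only exists if \<open>h\<close> has positive
  probability.\<close>

definition induced_strategy ::
  "('m \<times> 's \<Rightarrow> ('m \<times> 's) pmf) \<Rightarrow> 'm \<Rightarrow> 's list \<Rightarrow> 's pmf" where
  "induced_strategy u m0 h =
     bind_pmf (cond_pmf (chain_prefix u (m0, hd h) (length h - 1)) (lifts h))
       (\<lambda>w. map_pmf snd (u (last w)))"

definition implements ::
  "'s mdp \<Rightarrow> 's \<Rightarrow> ('m \<times> 's \<Rightarrow> ('m \<times> 's) pmf) \<Rightarrow> 'm \<Rightarrow> ('s list \<Rightarrow> 's pmf) \<Rightarrow> bool" where
  "implements M s0 u m0 \<sigma> \<longleftrightarrow>
     (\<forall>h \<in> partial_runs M s0.
        last h \<in> controlled M \<and> set_pmf (chain_prefix u (m0, s0) (length h - 1)) \<inter> lifts h \<noteq> {} \<longrightarrow>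
        \<sigma> h = induced_strategy u m0 h)"

text \<open>Only the cardinality of the set of modes matters, so modes are taken to be natural numbers.\<close>

definition FR_strategy :: "'s mdp \<Rightarrow> 's \<Rightarrow> ('s list \<Rightarrow> 's pmf) \<Rightarrow> bool" where
  "FR_strategy M s0 \<sigma> \<longleftrightarrow> \<sigma> \<in> strategies M s0 \<and>
     (\<exists>(Mem :: nat set) u. \<exists>m0 \<in> Mem.
        finite Mem \<and> update_function M Mem u \<and> implements M s0 u m0 \<sigma>)"

text \<open>The first memory component is the step counter, started at 0 and incremented in every step;
  the second one holds the \<open>k\<close> bits, whose updates, like the choices, may be randomized.\<close>

definition k_bit_modes :: "nat \<Rightarrow> (nat \<times> bool list) set" where
  "k_bit_modes k = UNIV \<times> {b. length b = k}"

definition counts_steps :: "'s mdp \<Rightarrow> nat \<Rightarrow>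
    ((nat \<times> bool list) \<times> 's \<Rightarrow> ((nat \<times> bool list) \<times> 's) pmf) \<Rightarrow> bool" where
  "counts_steps M k u \<longleftrightarrow>
     (\<forall>n b. \<forall>s \<in> states M. length b = k \<longrightarrow>
        (\<forall>((n', b'), s') \<in> set_pmf (u ((n, b), s)). n' = Suc n))"

definition k_bit_Markov_strategy :: "nat \<Rightarrow> 's mdp \<Rightarrow> 's \<Rightarrow> ('s list \<Rightarrow> 's pmf) \<Rightarrow> bool" where
  "k_bit_Markov_strategy k M s0 \<sigma> \<longleftrightarrow> \<sigma> \<in> strategies M s0 \<and>
     (\<exists>u b0. (0, b0) \<in> k_bit_modes k \<and> update_function M (k_bit_modes k) u \<and>
        counts_steps M k u \<and> implements M s0 u (0, b0) \<sigma>)"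

end

theory Submission
  imports Defs
begin

text \<open>
  The game proceeds in rounds. In round \<open>n\<close> an index \<open>i \<le> k n\<close> is drawn with probability
  \<open>\<delta>\<^sub>i\<close> and rewarded with \<open>W i\<close>, where the stake \<open>W\<close> dwarfs everything that happened before; then \<open>i\<close> is
  forgotten by the state, the controller guesses \<open>j \<le> k n\<close> and pays \<open>W j\<close>, and finally with
  probability \<open>r\<^sub>j\<close> it suffers a huge penalty. A guess \<open>j > i\<close> or a penalty pushes the mean payoff to \<open>-1\<close>
  or below; the next round starts with a compensation, so only infinitely many such failures
  matter. With \<open>\<delta>\<^sub>i\<close> proportional to \<open>Q\<^sup>i\<close> and \<open>r\<^sub>j = Q\<^sup>-\<^sup>(\<^sup>j\<^sup>+\<^sup>1\<^sup>)\<close>, the matching guess \<open>j = i\<close> fails with probability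
  \<open>\<Sum>\<^sub>i \<delta>\<^sub>i r\<^sub>i = (k n + 1) / (Z Q)\<close>, where \<open>Z = \<Sum>\<^sub>i Q\<^sup>i\<close>. A controller with at most \<open>k n\<close> memory
  modes must treat two indices \<open>i < i'\<close> alike, and then either overshoots \<open>i\<close> or runs a risk of at
  least \<open>r\<^sub>i\<close> at \<open>i'\<close>, so it fails with probability at least \<open>min \<delta>\<^sub>i (\<delta>\<^sub>i\<^sub>' r\<^sub>i) \<ge> 1 / Z\<close>, whatever happened
  before the round. Playing \<open>Z\<close> rounds for each value \<open>b\<close> of \<open>k n\<close>, with
  \<open>Q = (b + 1) 2\<^sup>b\<close>, makes the first bounds summable and the second ones not, and both claims follow in the style of Borel--Cantelli.
\<close>

section \<open>Finite prefixes of runs\<close>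

text \<open>Law of the first \<open>n + 1\<close> states. Events that depend on a bounded prefix
  become computations with discrete distributions.\<close>

fun prefix_pmf :: "'s mdp \<Rightarrow> 's \<Rightarrow> ('s list \<Rightarrow> 's pmf) \<Rightarrow> nat \<Rightarrow> 's list pmf" where
  "prefix_pmf M s0 \<sigma> 0 = return_pmf [s0]"
| "prefix_pmf M s0 \<sigma> (Suc n) =
     bind_pmf (prefix_pmf M s0 \<sigma> n) (\<lambda>h. map_pmf (\<lambda>s. h @ [s]) (next_state M \<sigma> h))"

text \<open>The list \<open>h @ [s]\<close> arises only from the draw \<open>h\<close>, so the
  integral over the first draw collapses to one term.\<close>

lemma pmf_bind_snoc:
  "pmf (bind_pmf p (\<lambda>h. map_pmf (\<lambda>s. h @ [s]) (q h))) (h @ [s]) = pmf p h * pmf (q h) s"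
proof -
  have "pmf (map_pmf (\<lambda>s. x @ [s]) (q x)) (h @ [s]) = indicator {h} x * pmf (q h) s" for x
  proof (cases "x = h")
    case True
    then show ?thesis
      using pmf_map_inj'[of "\<lambda>s. h @ [s]" "q h" s] by (simp add: inj_def)
  next
    case False
    then show ?thesis by (auto simp: pmf_eq_0_set_pmf)
  qed
  then have "pmf (bind_pmf p (\<lambda>h. map_pmf (\<lambda>s. h @ [s]) (q h))) (h @ [s]) =
      (\<integral>x. indicator {h} x * pmf (q h) s \<partial>measure_pmf p)"
    by (simp add: pmf_bind)
  also have "\<dots> = pmf p h * pmf (q h) s"
    by (simp add: measure_pmf_single)
  finally show ?thesis .
qed

lemma length_prefix_pmf: "h \<in> set_pmf (prefix_pmf M s0 \<sigma> n) \<Longrightarrow> length h = Suc n"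
  by (induction n arbitrary: h) auto

lemma emeasure_cylinder:
  assumes "h \<noteq> []"
  shows "emeasure (run_measure M s0 \<sigma>) (cylinder h) = pmf (prefix_pmf M s0 \<sigma> (length h - 1)) h"
  using assms
proof (induction h rule: rev_induct)
  case (snoc s h)
  show ?case
  proof (cases "h = []")
    case True
    then show ?thesis by (simp add: emeasure_cylinder_singleton)
  next
    case False
    then obtain n where n: "length h = Suc n" by (cases "length h") auto
    then have "emeasure (run_measure M s0 \<sigma>) (cylinder (h @ [s])) =
        ennreal (pmf (prefix_pmf M s0 \<sigma> n) h) * ennreal (pmf (next_state M \<sigma> h) s)"
      using snoc False by (simp add: emeasure_cylinder_snoc)
    then show ?thesis
      by (simp add: n pmf_bind_snoc ennreal_mult)
  qed
qed simp

lemma space_run_measure: "space (run_measure M s0 \<sigma>) = UNIV"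
  using sets_eq_imp_space_eq[OF sets_run_measure[of M s0 \<sigma>]] by (simp add: space_PiM)

lemma measurable_prefix:
  "(\<lambda>\<rho>. map \<rho> [0..<n]) \<in> measurable (run_measure M s0 \<sigma>) (count_space UNIV)"
proof -
  let ?P = "PiM UNIV (\<lambda>_ :: nat. count_space (UNIV :: 'a set))"
  have "{\<rho> \<in> space ?P. \<forall>i<length h. \<rho> i = h ! i} \<in> sets ?P" for h :: "'a list"
    by measurable
  moreover have "(\<lambda>\<rho>. map \<rho> [0..<n]) -` {h} =
      (if length h = n then {\<rho> \<in> space ?P. \<forall>i<length h. \<rho> i = h ! i} else {})" for h :: "'a list"
  proof -
    have "map \<rho> [0..<n] = h \<longleftrightarrow> length h = n \<and> (\<forall>i<length h. \<rho> i = h ! i)" for \<rho> :: "nat \<Rightarrow> 'a"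
      by (subst list_eq_iff_nth_eq) auto
    then show ?thesis by (auto simp: space_PiM)
  qed
  ultimately show ?thesis
    by (auto simp: measurable_count_space_eq_countable space_run_measure sets_run_measure)
qed

text \<open>On a countable space it suffices to compare singletons; their preimages are cylinders,
  and lists of the wrong length are null on both sides.\<close>

lemma measure_prefix:
  "measure (run_measure M s0 \<sigma>) {\<rho>. map \<rho> [0..<Suc n] \<in> A} = measure_pmf.prob (prefix_pmf M s0 \<sigma> n) A"
proof -
  let ?R = "run_measure M s0 \<sigma>" and ?f = "\<lambda>\<rho>. map \<rho> [0..<Suc n]"
  have eq: "distr ?R (count_space UNIV) ?f = measure_pmf (prefix_pmf M s0 \<sigma> n)"
  proof (rule measure_eqI_countable[of _ UNIV])
    fix h :: "'a list"
    have "?f -` {h} = (if length h = Suc n then cylinder h else {})"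
      by (auto simp: cylinder_def)
    then show "emeasure (distr ?R (count_space UNIV) ?f) {h} =
        emeasure (prefix_pmf M s0 \<sigma> n) {h}"
      using emeasure_cylinder[of h M s0 \<sigma>] length_prefix_pmf[of h M s0 \<sigma> n]
      by (simp add: emeasure_distr measurable_prefix space_run_measure emeasure_pmf_single
          del: upt_Suc)
        (auto simp: set_pmf_eq simp flip: length_greater_0_conv)
  qed auto
  show ?thesis
    unfolding eq[symmetric]
    by (subst measure_distr) (auto simp: measurable_prefix space_run_measure vimage_def simp del: upt_Suc)
qed

lemma sets_prefix: "{\<rho>. map \<rho> [0..<n] \<in> A} \<in> sets (run_measure M s0 \<sigma>)"
  using measurable_sets[OF measurable_prefix, of A n M s0 \<sigma>]
  by (simp add: space_run_measure vimage_def)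

lemma partial_runs_snoc:
  assumes "h \<in> partial_runs M s0" "s \<in> succs M (last h)"
  shows "h @ [s] \<in> partial_runs M s0"
  using assms by (auto simp: partial_runs_def succs_def successively_append_iff)

lemma next_state_succs:
  assumes "is_mdp M" "\<sigma> \<in> strategies M s0" "h \<in> partial_runs M s0" "last h \<in> states M"
  shows "set_pmf (next_state M \<sigma> h) \<subseteq> succs M (last h)"
  using assms unfolding is_mdp_def strategies_def next_state_def states_def by auto

lemma set_prefix_pmf:
  assumes M: "is_mdp M" "s0 \<in> states M" and \<sigma>: "\<sigma> \<in> strategies M s0"
    and "h \<in> set_pmf (prefix_pmf M s0 \<sigma> n)"
  shows "h \<in> partial_runs M s0 \<and> last h \<in> states M"
  using assms(4)
proof (induction n arbitrary: h)
  case 0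
  then show ?case using M by (simp add: partial_runs_def)
next
  case (Suc n)
  then obtain g s where g: "g \<in> set_pmf (prefix_pmf M s0 \<sigma> n)"
    and s: "s \<in> set_pmf (next_state M \<sigma> g)" "h = g @ [s]"
    by auto
  have "s \<in> succs M (last g)"
    using next_state_succs[OF M(1) \<sigma>] Suc.IH[OF g] s by blast
  then show ?case
    using M(1) partial_runs_snoc Suc.IH[OF g] s by (auto simp: is_mdp_def succs_def)
qed

text \<open>Being a run is a countable conjunction of conditions on prefixes, each of which holds
  almost surely.\<close>

lemma AE_runs:
  assumes "is_mdp M" "s0 \<in> states M" "\<sigma> \<in> strategies M s0"
  shows "AE \<rho> in run_measure M s0 \<sigma>. \<rho> \<in> runs M s0"
proof -
  interpret prob_space "run_measure M s0 \<sigma>" by (rule prob_space_run_measure)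
  have "AE \<rho> in run_measure M s0 \<sigma>. map \<rho> [0..<Suc n] \<in> partial_runs M s0" for n
  proof -
    have "measure_pmf.prob (prefix_pmf M s0 \<sigma> n) (partial_runs M s0) = 1"
      using set_prefix_pmf[OF assms]
      by (subst measure_pmf.prob_eq_1) (auto simp: AE_measure_pmf_iff)
    then show ?thesis
      using AE_prob_1[of "{\<rho>. map \<rho> [0..<Suc n] \<in> partial_runs M s0}"]
      by (simp only: measure_prefix) simp
  qed
  then have "AE \<rho> in run_measure M s0 \<sigma>. \<forall>n. map \<rho> [0..<Suc n] \<in> partial_runs M s0"
    by (simp add: AE_all_countable)
  then show ?thesis
  proof (rule AE_mp, intro AE_I2 impI)
    fix \<rho> assume *: "\<forall>n. map \<rho> [0..<Suc n] \<in> partial_runs M s0"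
    have "\<rho> 0 = s0" using *[rule_format, of 0] by (simp add: partial_runs_def)
    moreover have "(\<rho> i, \<rho> (Suc i)) \<in> transitions M" for i
      using *[rule_format, of "Suc i"]
      by (auto simp: partial_runs_def successively_append_iff)
    ultimately show "\<rho> \<in> runs M s0" by (simp add: runs_def)
  qed
qed

section \<open>Strategies with memory as Markov chains on modes and states\<close>

lemma bind_cond_pmf_vimage:
  "bind_pmf (map_pmf f p) (\<lambda>y. cond_pmf p {x. f x = y}) = p"
proof -
  have "{x. f x = y} = {x. y = f x}" for y by auto
  moreover have "bind_pmf (map_pmf f p) (\<lambda>y. cond_pmf p {x. y = f x}) = p"
  proof (rule bind_cond_pmf_cancel)
    fix y x assume "y = f x"
    then show "measure_pmf.prob p {x. y = f x} = measure_pmf.prob (map_pmf f p) {y. y = f x}"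
      by (auto simp: vimage_def intro!: arg_cong[where f = "measure_pmf.prob p"])
  qed auto
  ultimately show ?thesis by simp
qed

lemma length_chain_prefix: "w \<in> set_pmf (chain_prefix u x n) \<Longrightarrow> length w = Suc n"
  by (induction n arbitrary: w) auto

text \<open>Modes and states may be confined to sets that vary with time, as needed for step
  counters and for the layers of the game.\<close>

lemma chain_prefix_invariant:
  assumes "\<And>n m s. m \<in> A n \<Longrightarrow> s \<in> B n \<Longrightarrow> set_pmf (u (m, s)) \<subseteq> A (Suc n) \<times> B (Suc n)"
    and "m0 \<in> A 0" "s0 \<in> B 0" "w \<in> set_pmf (chain_prefix u (m0, s0) n)"
  shows "last w \<in> A n \<times> B n"
  using assms(4)
proof (induction n arbitrary: w)
  case 0
  then show ?case using assms(2,3) by simp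
next
  case (Suc n)
  then obtain v y where v: "v \<in> set_pmf (chain_prefix u (m0, s0) n)"
    and y: "y \<in> set_pmf (u (last v))" "w = v @ [y]"
    by auto
  obtain m s where ms: "last v = (m, s)" by fastforce
  then show ?case using Suc.IH[OF v] y assms(1)[of m n s] by auto
qed

lemma update_function_succs:
  assumes "is_mdp M" "update_function M Mem u" "m \<in> Mem" "s \<in> states M"
  shows "set_pmf (u (m, s)) \<subseteq> Mem \<times> succs M s"
proof (cases "s \<in> controlled M")
  case True
  then show ?thesis using assms by (auto simp: update_function_def)
next
  case False
  then have s: "s \<in> random M" using assms by (auto simp: states_def)
  then have *: "set_pmf (u (m, s)) \<subseteq> Mem \<times> UNIV" "map_pmf snd (u (m, s)) = trans_prob M s"
    using assms(2,3) unfolding update_function_def by blast+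
  have "snd ` set_pmf (u (m, s)) \<subseteq> succs M s"
    using assms(1) s unfolding set_map_pmf[symmetric] *(2) by (simp add: is_mdp_def)
  then show ?thesis using *(1) by (auto dest: imageI[of _ _ snd])
qed

lemma succs_subset_states: "is_mdp M \<Longrightarrow> succs M s \<subseteq> states M"
  by (auto simp: is_mdp_def succs_def)

text \<open>The induced strategy averages over the mode conditioned on the history. Averaging over
  the history as well undoes the conditioning, so later estimates can be made on the chain of modes
  and states.\<close>

lemma prefix_pmf_implements:
  assumes M: "is_mdp M" "s0 \<in> states M" and \<sigma>: "\<sigma> \<in> strategies M s0"
    and u: "update_function M Mem u" "m0 \<in> Mem" "implements M s0 u m0 \<sigma>"
  shows "prefix_pmf M s0 \<sigma> n = map_pmf (map snd) (chain_prefix u (m0, s0) n)"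
proof (induction n)
  case (Suc n)
  let ?C = "chain_prefix u (m0, s0) n"
  have last_C: "last w \<in> Mem \<times> states M" if "w \<in> set_pmf ?C" for w
  proof (rule chain_prefix_invariant[where A = "\<lambda>_. Mem" and B = "\<lambda>_. states M"])
    show "set_pmf (u (m, s)) \<subseteq> Mem \<times> states M" if "m \<in> Mem" "s \<in> states M" for m s
      using update_function_succs[OF M(1) u(1) that] succs_subset_states[OF M(1)] by blast
  qed (use M u that in auto)
  \<comment> \<open>One formula for both kinds of states: at random ones the state marginal of
    \<open>u\<close> does not depend on the mode, so averaging over modes changes nothing.\<close>
  have next_eq: "next_state M \<sigma> h =
      bind_pmf (cond_pmf ?C (lifts h)) (\<lambda>w. map_pmf snd (u (last w)))"
    if h: "h \<in> set_pmf (prefix_pmf M s0 \<sigma> n)" for h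
  proof -
    note h_run = set_prefix_pmf[OF M \<sigma> h] and len = length_prefix_pmf[OF h]
    have lifts: "set_pmf ?C \<inter> lifts h \<noteq> {}"
      using h unfolding Suc.IH by (auto simp: lifts_def)
    show ?thesis
    proof (cases "last h \<in> controlled M")
      case True
      have "hd h = s0" using h_run by (simp add: partial_runs_def)
      then show ?thesis
        using u(3) h_run True lifts len
        by (simp add: implements_def next_state_def induced_strategy_def)
    next
      case False
      then have "last h \<in> random M" using h_run by (auto simp: states_def)
      moreover have snd_last: "snd (last w) = last h" if "w \<in> set_pmf ?C \<inter> lifts h" for w
        using that length_chain_prefix[of w u "(m0, s0)" n]
        by (cases "w = []") (auto simp: lifts_def last_map)
      ultimately have "map_pmf snd (u (last w)) = trans_prob M (last h)"
        if "w \<in> set_pmf ?C \<inter> lifts h" for w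
      proof -
        have "last w \<in> Mem \<times> {last h}"
          using snd_last[OF that] last_C[of w] that by (cases "last w") auto
        then obtain m where "last w = (m, last h)" "m \<in> Mem" by auto
        then show ?thesis
          using u(1) \<open>last h \<in> random M\<close> by (simp add: update_function_def)
      qed
      then have "bind_pmf (cond_pmf ?C (lifts h)) (\<lambda>w. map_pmf snd (u (last w))) =
          bind_pmf (cond_pmf ?C (lifts h)) (\<lambda>w. trans_prob M (last h))"
        using lifts by (intro bind_pmf_cong refl) simp
      then show ?thesis
        using False by (simp add: next_state_def)
    qed
  qed
  have "prefix_pmf M s0 \<sigma> (Suc n) = bind_pmf (map_pmf (map snd) ?C) (\<lambda>h.
      bind_pmf (cond_pmf ?C (lifts h)) (\<lambda>w. map_pmf (\<lambda>s. h @ [s]) (map_pmf snd (u (last w)))))"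
    unfolding prefix_pmf.simps map_bind_pmf[symmetric]
    by (simp only: Suc.IH[symmetric]) (intro bind_pmf_cong refl, simp add: next_eq map_bind_pmf)
  also have "\<dots> = bind_pmf (map_pmf (map snd) ?C) (\<lambda>h.
      bind_pmf (cond_pmf ?C (lifts h)) (\<lambda>w. map_pmf (map snd) (map_pmf (\<lambda>y. w @ [y]) (u (last w)))))"
  proof (intro bind_pmf_cong refl)
    fix h w assume h: "h \<in> set_pmf (map_pmf (map snd) ?C)" and w: "w \<in> set_pmf (cond_pmf ?C (lifts h))"
    have "set_pmf ?C \<inter> lifts h \<noteq> {}" using h by (auto simp: lifts_def)
    then have "map snd w = h" using w by (simp add: lifts_def)
    then show "map_pmf (\<lambda>s. h @ [s]) (map_pmf snd (u (last w))) =
        map_pmf (map snd) (map_pmf (\<lambda>y. w @ [y]) (u (last w)))"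
      by (auto simp: pmf.map_comp o_def)
  qed
  also have "\<dots> = bind_pmf (bind_pmf (map_pmf (map snd) ?C) (\<lambda>h. cond_pmf ?C (lifts h)))
      (\<lambda>w. map_pmf (map snd) (map_pmf (\<lambda>y. w @ [y]) (u (last w))))"
    by (simp add: bind_assoc_pmf)
  \<comment> \<open>Drawing a history and then a lift of it conditioned on that history amounts to
    drawing the lift directly.\<close>
  also have "\<dots> = map_pmf (map snd) (chain_prefix u (m0, s0) (Suc n))"
    unfolding lifts_def bind_cond_pmf_vimage by (simp add: map_bind_pmf)
  finally show ?case .
qed simp

section \<open>One round as a guessing problem\<close>

definition base :: "nat \<Rightarrow> nat" where
  "base b = (b + 1) * 2 ^ b"

definition weight_sum :: "nat \<Rightarrow> nat" where
  "weight_sum b = (\<Sum>i\<le>b. base b ^ i)"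

definition risk :: "nat \<Rightarrow> nat \<Rightarrow> real" where
  "risk b j = 1 / real (base b) ^ Suc j"

definition index_pmf :: "nat \<Rightarrow> nat pmf" where
  "index_pmf b = embed_pmf (\<lambda>i. if i \<le> b then real (base b) ^ i / real (weight_sum b) else 0)"

lemma base_pos: "base b > 0"
  by (simp add: base_def)

lemma weight_sum_pos: "weight_sum b > 0"
  using base_pos[of b] by (auto simp: weight_sum_def intro!: sum_pos)

lemma pmf_index: "pmf (index_pmf b) i = (if i \<le> b then real (base b) ^ i / real (weight_sum b) else 0)"
  unfolding index_pmf_def
proof (rule pmf_embed_pmf)
  let ?f = "\<lambda>i. if i \<le> b then real (base b) ^ i / real (weight_sum b) else 0"
  have "(\<integral>\<^sup>+i. ennreal (?f i) \<partial>count_space UNIV) = (\<Sum>i\<le>b. ennreal (?f i))"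
    by (rule nn_integral_count_space') auto
  also have "\<dots> = ennreal (\<Sum>i\<le>b. ?f i)"
    by (rule sum_ennreal) auto
  also have "(\<Sum>i\<le>b. ?f i) = 1"
    using weight_sum_pos[of b] base_pos[of b] by (auto simp: weight_sum_def simp flip: sum_divide_distrib of_nat_power of_nat_sum)
  finally show "(\<integral>\<^sup>+i. ennreal (?f i) \<partial>count_space UNIV) = 1" by simp
qed auto

lemma set_index_pmf: "set_pmf (index_pmf b) = {..b}"
  using base_pos[of b] weight_sum_pos[of b] by (auto simp: set_pmf_eq pmf_index)

lemma risk_bounds: "0 < risk b j" "risk b j \<le> 1"
  using base_pos[of b] using one_le_power[of "real (base b)" "Suc j"]
  by (auto simp: risk_def simp del: power_Suc)

text \<open>The power in the weight of an index cancels against the one in its risk, so all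
  \<open>b + 1\<close> indices contribute equally.\<close>

lemma expected_risk:
  "measure_pmf.expectation (index_pmf b) (risk b) = (real b + 1) / (real (weight_sum b) * real (base b))"
proof -
  have "measure_pmf.expectation (index_pmf b) (risk b) = (\<Sum>i\<le>b. risk b i * pmf (index_pmf b) i)"
    by (rule integral_measure_pmf_real) (auto simp: set_index_pmf)
  also have "\<dots> = (\<Sum>i\<le>b. 1 / (real (weight_sum b) * real (base b)))"
    using base_pos[of b] by (intro sum.cong) (auto simp: pmf_index risk_def field_simps)
  finally show ?thesis by simp
qed

text \<open>Here \<open>f i\<close> is the mode used at index \<open>i\<close>, and
  \<open>p m\<close> the guess made from mode \<open>m\<close>. With \<open>b + 1\<close> indices
  and at most \<open>b\<close> modes, two indices share a guess, which cannot serve both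
  well.\<close>

lemma bounded_memory_loss:
  assumes A: "finite A" "card A \<le> b" and f: "f ` {..b} \<subseteq> A"
  shows "(\<Sum>i\<le>b. pmf (index_pmf b) i *
      measure_pmf.expectation (p (f i)) (\<lambda>j. if j \<le> i then 1 - risk b j else 0)) \<le> 1 - 1 / real (weight_sum b)"
proof -
  let ?d = "pmf (index_pmf b)"
  define g where "g i j = (if j \<le> i then 1 - risk b j else 0)" for i j :: nat
  define E where "E i = measure_pmf.expectation (p (f i)) (g i)" for i
  have g: "0 \<le> g i j" "g i j \<le> 1" for i j
    using risk_bounds[of b j] by (auto simp: g_def)
  have int: "integrable (measure_pmf q) (g i)" for q i
    by (rule measure_pmf.integrable_const_bound[where B = 1]) (use g in auto)
  have E_le: "E i \<le> 1" for i
    unfolding E_def by (rule measure_pmf.integral_le_const[OF int]) (simp add: g)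
  have "\<not> inj_on f {..b}"
    using card_mono[OF A(1) f] A(2) by (intro pigeonhole) simp
  then obtain i i' where ii: "i < i'" "i' \<le> b" "f i = f i'"
    unfolding inj_on_def by (metis atMost_iff linorder_neqE_nat)
  \<comment> \<open>The bound holds for each fixed \<open>j\<close>, so integration extends it to
    randomized guesses. If \<open>j > i\<close>, index \<open>i\<close> is lost, with weight at
    least \<open>1 / weight_sum b\<close>; if \<open>j \<le> i\<close>, the risk taken at
    \<open>i'\<close> costs at least as much.\<close>
  have le: "?d i * g i j + ?d i' * g i' j \<le> ?d i + ?d i' - 1 / weight_sum b" for j
  proof -
    have d: "?d l = real (base b) ^ l / weight_sum b" if "l \<le> b" for l
      using that by (simp add: pmf_index)
    have Q: "real (base b) \<ge> 1" using base_pos[of b] by simp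
    have d_i: "?d i \<ge> 1 / weight_sum b"
      using ii Q one_le_power[OF Q, of i] by (simp add: d divide_right_mono)
    show ?thesis
    proof (cases "j \<le> i'")
      case False
      then show ?thesis using ii d_i by (simp add: g_def add_increasing2)
    next
      case True
      show ?thesis
      proof (cases "j \<le> i")
        case False
        have "?d i' * (1 - risk b j) \<le> ?d i' * 1"
          using risk_bounds[of b j] by (intro mult_left_mono) auto
        then show ?thesis using False True d_i by (simp add: g_def)
      next
        case j: True
        have "real (base b) ^ Suc j \<le> real (base b) ^ i'"
          using ii j Q by (intro power_increasing) auto
        then have "1 / weight_sum b \<le> ?d i' * risk b j"
          using ii base_pos[of b] weight_sum_pos[of b] by (simp add: d risk_def field_simps)
        moreover have "0 \<le> ?d i * risk b j"
          using risk_bounds[of b j] by simp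
        ultimately show ?thesis using j True by (simp add: g_def algebra_simps)
      qed
    qed
  qed
  have "?d i * E i + ?d i' * E i' =
      measure_pmf.expectation (p (f i)) (\<lambda>j. ?d i * g i j + ?d i' * g i' j)"
    using ii(3) int by (simp add: E_def)
  also have "\<dots> \<le> ?d i + ?d i' - 1 / weight_sum b"
    by (rule measure_pmf.integral_le_const) (use int le in auto)
  finally have pair: "?d i * E i + ?d i' * E i' \<le> ?d i + ?d i' - 1 / weight_sum b" .
  have split: "(\<Sum>l\<le>b. h l) = h i + h i' + (\<Sum>l \<in> {..b} - {i, i'}. h l)" for h :: "nat \<Rightarrow> real"
    using ii by (subst sum.subset_diff[of "{i, i'}"]) auto
  have "(\<Sum>l \<in> {..b} - {i, i'}. ?d l * E l) \<le> (\<Sum>l \<in> {..b} - {i, i'}. ?d l)"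
    using E_le by (intro sum_mono mult_left_le) auto
  moreover have "(\<Sum>l\<le>b. ?d l) = 1"
    by (rule sum_pmf_eq_1) (auto simp: set_index_pmf)
  ultimately have "(\<Sum>l\<le>b. ?d l * E l) \<le> 1 - 1 / weight_sum b"
    using pair split[of "\<lambda>l. ?d l * E l"] split[of ?d] by simp
  then show ?thesis by (simp add: E_def g_def[abs_def])
qed

text \<open>Each \<open>b\<close> is taken exactly \<open>weight_sum b\<close> times, in an arbitrary order.\<close>

lemma exists_schedule:
  obtains k :: "nat \<Rightarrow> nat"
  where "summable (\<lambda>n. measure_pmf.expectation (index_pmf (k n)) (risk (k n)))"
    and "\<And>K. \<not> summable (\<lambda>n. if K \<le> k n then 1 / real (weight_sum (k n)) else 0)"
proof -
  define S where "S = (SIGMA b:UNIV. {..<weight_sum b})"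
  define k where "k n = fst (from_nat_into S n)" for n
  have "S \<supseteq> range (\<lambda>b. (b, 0))" using weight_sum_pos by (auto simp: S_def)
  moreover have "infinite (range (\<lambda>b::nat. (b, 0::nat)))"
    by (subst finite_image_iff) (auto simp: inj_on_def)
  ultimately have "infinite S" using finite_subset by blast
  then have bij: "bij_betw (from_nat_into S) UNIV S"
    by (intro bij_betw_from_nat_into) auto
  \<comment> \<open>For nonnegative terms summability does not depend on the order, so series over
    rounds can be summed in blocks of equal \<open>b\<close>.\<close>
  have summable_iff: "summable (\<lambda>n. F (k n)) \<longleftrightarrow> (\<lambda>p. F (fst p)) summable_on S"
    if "\<And>b. F b \<ge> 0" for F :: "nat \<Rightarrow> real"
    using summable_on_reindex_bij_betw[OF bij, of "\<lambda>p. F (fst p)"] that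
    by (simp add: k_def summable_on_UNIV_nonneg_real_iff)
  have sum1: "summable (\<lambda>n. measure_pmf.expectation (index_pmf (k n)) (risk (k n)))"
  proof -
    let ?F = "\<lambda>b. (real b + 1) / (real (weight_sum b) * real (base b))"
    have "(\<lambda>p. ?F (fst p)) summable_on S"
      unfolding S_def
    proof (rule summable_on_SigmaI)
      \<comment> \<open>The \<open>weight_sum b\<close> copies of \<open>b\<close> contribute
        \<open>(b + 1) / base b\<close>, which the choice of \<open>base\<close> turns into a
        geometric series.\<close>
      show "((\<lambda>y. ?F (fst (b, y))) has_sum (1 / 2) ^ b) {..<weight_sum b}" for b
      proof (rule has_sum_finiteI)
        have "2 ^ b + real b * 2 ^ b = (real b + 1) * 2 ^ b" by (simp add: algebra_simps)
        then show "(1 / 2) ^ b = (\<Sum>y<weight_sum b. ?F (fst (b, y)))"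
          using weight_sum_pos[of b] by (simp add: base_def power_divide)
      qed simp
      show "(\<lambda>b. (1 / 2 :: real) ^ b) summable_on UNIV"
        by (subst summable_on_UNIV_nonneg_real_iff) auto
    qed simp
    then show ?thesis using summable_iff[of ?F] by (simp add: expected_risk)
  qed
  have sum2: "\<not> summable (\<lambda>n. if K \<le> k n then 1 / real (weight_sum (k n)) else 0)" for K
  proof
    let ?F = "\<lambda>b. if K \<le> b then 1 / real (weight_sum b) else 0"
    assume "summable (\<lambda>n. ?F (k n))"
    then have "(\<lambda>(b, y). ?F b) summable_on S"
      by (subst (asm) summable_iff) (auto simp: case_prod_unfold)
    then have "(\<lambda>b. infsum (\<lambda>y. ?F b) {..<weight_sum b}) summable_on UNIV"
      unfolding S_def by (rule summable_on_Sigma_banach)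
    \<comment> \<open>Each block with \<open>b \<ge> K\<close> sums to exactly 1, so the block sums
      do not tend to 0.\<close>
    also have "(\<lambda>b. infsum (\<lambda>y. ?F b) {..<weight_sum b}) = (\<lambda>b. of_bool (K \<le> b))"
      by (auto simp: fun_eq_iff) (metis weight_sum_pos less_irrefl)
    finally have "summable (\<lambda>b. of_bool (K \<le> b) :: real)"
      by (subst (asm) summable_on_UNIV_nonneg_real_iff) auto
    then have "(\<lambda>b. of_bool (K \<le> b) :: real) \<longlonglongrightarrow> 0" by (rule summable_LIMSEQ_zero)
    moreover have "(\<lambda>b. of_bool (K \<le> b) :: real) \<longlonglongrightarrow> 1"
      by (rule tendsto_eventually) (auto simp: eventually_at_top_linorder intro: exI[of _ K])
    ultimately show False using LIMSEQ_unique by fastforce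
  qed
  show ?thesis using that[OF sum1 sum2] .
qed

section \<open>The game\<close>

lemma emeasure_bind_pmf_le:
  assumes "\<And>x. x \<in> set_pmf p \<Longrightarrow> emeasure (measure_pmf (f x)) A \<le> c"
  shows "emeasure (bind_pmf p f) A \<le> c"
proof -
  have "emeasure (bind_pmf p f) A \<le> (\<integral>\<^sup>+x. c \<partial>p)"
    unfolding emeasure_bind_pmf
    by (rule nn_integral_mono_AE) (simp add: AE_measure_pmf_iff assms)
  then show ?thesis by (simp add: measure_pmf.emeasure_space_1)
qed

context
  fixes k :: "nat \<Rightarrow> nat"
begin

text \<open>A state encodes a time \<open>t\<close> and a value \<open>v \<le> width t\<close>; any two states of consecutive layers are
  joined by a transition. Round \<open>n\<close> occupies the times \<open>4 n\<close> (drawing the index), \<open>4 n + 1\<close>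
  (forgetting it), \<open>4 n + 2\<close> (guessing) and \<open>4 n + 3\<close> (taking the risk); since transitions are pairs of states,
  each outcome is recorded as the value of the next state.\<close>

definition width :: "nat \<Rightarrow> nat" where
  "width t = (if t mod 4 = 0 then 1 else if t mod 4 = 2 then 0 else k (t div 4))"

definition layer :: "nat \<Rightarrow> nat set" where
  "layer t = (\<lambda>v. prod_encode (t, v)) ` {..width t}"

definition choice_pmf :: "nat \<Rightarrow> nat \<Rightarrow> nat pmf" where
  "choice_pmf t v =
     (if t mod 4 = 0 then index_pmf (k (t div 4))
      else if t mod 4 = 3 then map_pmf of_bool (bernoulli_pmf (risk (k (t div 4)) v))
      else return_pmf 0)"

text \<open>\<open>reserve n\<close> bounds the absolute value of the total reward before round \<open>n\<close>
  and is granted as a compensation at its beginning.\<close>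

primrec reserve :: "nat \<Rightarrow> nat" where
  "reserve 0 = 0"
| "reserve (Suc n) = 2 * reserve n + (2 * reserve n + 4 * n + 4) * (3 * k n + 1)"

text \<open>Outweighs earlier gains of at most \<open>reserve n\<close>, the equal compensation, and
  the time \<open>4 * n + 4\<close> at the end of the round, so that losing one stake brings the
  mean payoff to -1 or below.\<close>

definition stake :: "nat \<Rightarrow> nat" where
  "stake n = 2 * reserve n + 4 * n + 4"

text \<open>\<open>w\<close> is the value of the target state, where the outcome of the step is
  recorded. The factor \<open>k n + 1\<close> exceeds every index, so a penalty costs at least one
  stake more than any prize.\<close>

definition payoff :: "nat \<Rightarrow> nat \<Rightarrow> int" where
  "payoff t w = (let n = t div 4 in
     if t mod 4 = 0 then int (reserve n + stake n * w)
     else if t mod 4 = 2 then - int (stake n * w)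
     else if t mod 4 = 3 then - int (stake n * (k n + 1) * w)
     else 0)"

definition game :: "nat mdp" where
  "game = \<lparr>controlled = (\<Union>t \<in> {t. t mod 4 = 2}. layer t),
     random = (\<Union>t \<in> {t. t mod 4 \<noteq> 2}. layer t),
     transitions = (\<Union>t. layer t \<times> layer (Suc t)),
     trans_prob = (\<lambda>s. case prod_decode s of (t, v) \<Rightarrow>
       map_pmf (\<lambda>w. prod_encode (Suc t, w)) (choice_pmf t v)),
     reward = (\<lambda>(s, s'). of_int (payoff (fst (prod_decode s)) (snd (prod_decode s'))))\<rparr>"

abbreviation init :: nat where
  "init \<equiv> prod_encode (0, 0)"

abbreviation val :: "nat \<Rightarrow> nat" where
  "val s \<equiv> snd (prod_decode s)"

section \<open>Structural properties of the game\<close>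

lemma val_le_width: "s \<in> layer t \<Longrightarrow> val s \<le> width t"
  by (auto simp: layer_def)

lemma layer_unique: "s \<in> layer t \<Longrightarrow> s \<in> layer t' \<Longrightarrow> t = t'"
  by (auto simp: layer_def)

lemma layer_iff: "prod_encode (t, v) \<in> layer t' \<longleftrightarrow> t = t' \<and> v \<le> width t"
  by (auto simp: layer_def)

lemma layer_nonempty: "layer t \<noteq> {}"
  by (auto simp: layer_def)

lemma finite_layer: "finite (layer t)"
  by (simp add: layer_def)

lemma states_game: "states game = (\<Union>t. layer t)"
  by (auto simp: states_def game_def)

lemma controlled_game: "s \<in> layer t \<Longrightarrow> s \<in> controlled game \<longleftrightarrow> t mod 4 = 2"
  by (auto simp: game_def dest: layer_unique)

lemma random_game: "s \<in> layer t \<Longrightarrow> s \<in> random game \<longleftrightarrow> t mod 4 \<noteq> 2"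
  by (auto simp: game_def dest: layer_unique)

lemma transitions_game: "s \<in> layer t \<Longrightarrow> (s, s') \<in> transitions game \<longleftrightarrow> s' \<in> layer (Suc t)"
  by (auto simp: game_def dest: layer_unique)

lemma succs_game: "s \<in> layer t \<Longrightarrow> succs game s = layer (Suc t)"
  by (auto simp: succs_def transitions_game)

lemma trans_prob_game:
  "s \<in> layer t \<Longrightarrow>
    trans_prob game s = map_pmf (\<lambda>w. prod_encode (Suc t, w)) (choice_pmf t (val s))"
  by (auto simp: game_def layer_def)

lemma width_round:
  "width (4 * n) = 1" "width (4 * n + 1) = k n" "width (4 * n + 2) = 0" "width (4 * n + 3) = k n"
  "width (4 * n + 4) = 1"
proof -
  have "(4 * n + 1) div 4 = n" "(4 * n + 3) div 4 = n"
    "(4 * n + 1) mod 4 = 1" "(4 * n + 2) mod 4 = 2" "(4 * n + 3) mod 4 = 3" "(4 * n + 4) mod 4 = 0"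
    by presburger+
  then show "width (4 * n) = 1" "width (4 * n + 1) = k n" "width (4 * n + 2) = 0"
    "width (4 * n + 3) = k n" "width (4 * n + 4) = 1"
    unfolding width_def by simp_all
qed

lemma set_choice_pmf: "t mod 4 \<noteq> 2 \<Longrightarrow> set_pmf (choice_pmf t v) \<subseteq> {..width (Suc t)}"
proof -
  assume "t mod 4 \<noteq> 2"
  then have "t mod 4 = 0 \<or> t mod 4 = 1 \<or> t mod 4 = 3" by linarith
  then show ?thesis
    by (elim disjE) (auto simp: choice_pmf_def width_def set_index_pmf mod_Suc div_Suc)
qed

lemma is_mdp_game: "is_mdp game"
proof -
  have "controlled game \<inter> random game = {}"
    by (auto simp: game_def dest: layer_unique)
  moreover have "set_pmf (trans_prob game s) \<subseteq> succs game s" if "s \<in> random game" for s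
  proof -
    have "\<exists>t. s \<in> layer t \<and> t mod 4 \<noteq> 2" using that by (simp add: game_def) blast
    then obtain t where "s \<in> layer t" "t mod 4 \<noteq> 2" by blast
    then show ?thesis
      using set_choice_pmf[of t "val s"]
      by (auto simp: trans_prob_game succs_game layer_iff)
  qed
  moreover have "transitions game \<subseteq> states game \<times> states game"
    unfolding states_game by (auto simp: game_def)
  ultimately show ?thesis
    unfolding is_mdp_def using layer_nonempty by (auto simp: states_game succs_game)
qed

lemma finitely_branching_game: "finitely_branching game"
  by (auto simp: finitely_branching_def states_game succs_game finite_layer)

lemma acyclic_game: "acyclic (transitions game)"
proof -
  have "fst (prod_decode s) < fst (prod_decode s')" if "(s, s') \<in> (transitions game)\<^sup>+" for s s'
    using that by (induction rule: trancl_induct) (auto simp: game_def layer_def)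
  then show ?thesis by (auto simp: acyclic_def)
qed

lemma integer_rewards_game: "integer_rewards game"
  by (auto simp: integer_rewards_def game_def)

lemma partial_runs_game:
  assumes "h \<in> partial_runs game init" "i < length h"
  shows "h ! i \<in> layer i"
  using assms(2)
proof (induction i)
  case 0
  then show ?case using assms(1) by (auto simp: partial_runs_def hd_conv_nth layer_iff)
next
  case (Suc i)
  moreover have "(h ! i, h ! Suc i) \<in> transitions game"
    using assms(1) Suc.prems by (auto simp: partial_runs_def successively_conv_nth)
  ultimately show ?case using transitions_game[of "h ! i" i] by simp
qed

lemma last_partial_runs_game:
  "h \<in> partial_runs game init \<Longrightarrow> last h \<in> layer (length h - 1)"
  using partial_runs_game[of h "length h - 1"] by (simp add: partial_runs_def last_conv_nth)

text \<open>Layers are disjoint, so the final state of a path determines its time.\<close>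

lemma step_counter_implicit_game: "step_counter_implicit game init"
  unfolding step_counter_implicit_def
proof (intro ballI impI)
  fix h h' assume h: "h \<in> partial_runs game init" "h' \<in> partial_runs game init"
    and "last h = last h'"
  then have "length h - 1 = length h' - 1"
    using last_partial_runs_game layer_unique by metis
  moreover have "h \<noteq> []" "h' \<noteq> []" using h by (auto simp: partial_runs_def)
  ultimately show "length h = length h'" by (cases h; cases h') auto
qed

lemma runs_game: "\<rho> \<in> runs game init \<Longrightarrow> \<rho> t \<in> layer t"
proof (induction t)
  case (Suc t)
  then show ?case using transitions_game[of "\<rho> t" t "\<rho> (Suc t)"] by (simp add: runs_def)
qed (simp add: runs_def layer_iff)

lemma initial_game: "init \<in> states game"
  by (auto simp: states_game layer_iff)

text \<open>In round \<open>n\<close> the random index is \<open>v (4 n + 1)\<close>, the controller's guess is \<open>v (4 n + 3)\<close>, and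
  \<open>v (4 n + 4)\<close> is the outcome of the risk taken by the guess.\<close>

definition fails :: "(nat \<Rightarrow> nat) \<Rightarrow> nat \<Rightarrow> bool" where
  "fails v n \<longleftrightarrow> v (4 * n + 1) < v (4 * n + 3) \<or> v (4 * n + 4) \<noteq> 0"

lemma round_cases:
  fixes t :: nat
  assumes "t > 0"
  obtains n where "t = 4 * n + 1 \<or> t = 4 * n + 2 \<or> t = 4 * n + 3 \<or> t = 4 * n + 4"
proof -
  have "(t - 1) mod 4 < 4" by simp
  then show ?thesis
    using that[of "(t - 1) div 4"] mult_div_mod_eq[of 4 "t - 1"] assms by linarith
qed

section \<open>Partial payoff sums along a fixed sequence of values\<close>

context
  fixes v :: "nat \<Rightarrow> nat" and S :: "nat \<Rightarrow> int"
  assumes v: "\<And>t. v t \<le> width t"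
  defines "S \<equiv> \<lambda>n. \<Sum>t<n. payoff t (v (Suc t))"
begin

lemma round_values: "v (4 * n + 1) \<le> k n" "v (4 * n + 3) \<le> k n" "v (4 * n + 4) \<le> 1"
  using v[of "4 * n + 1"] v[of "4 * n + 3"] v[of "4 * n + 4"] unfolding width_round .

text \<open>Splits a round into compensation, prize \<open>a\<close>, payment \<open>b\<close> and
  penalty \<open>c\<close>, with the linear bounds from which later arguments follow by
  \<open>linarith\<close>.\<close>

lemma round_sums:
  obtains a b c :: int
  where "S (4 * n + 1) = S (4 * n) + reserve n + a" "S (4 * n + 2) = S (4 * n + 1)"
    "S (4 * n + 3) = S (4 * n + 2) - b" "S (4 * n + 4) = S (4 * n + 3) - c"
    "0 \<le> a" "a \<le> stake n * k n" "0 \<le> b" "b \<le> stake n * k n" "0 \<le> c" "c \<le> stake n * k n + stake n"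
    "fails v n \<Longrightarrow> a + stake n \<le> b \<or> c = stake n * k n + stake n"
    "\<not> fails v n \<Longrightarrow> b \<le> a \<and> c = 0"
proof -
  define a b c where "a = stake n * v (4 * n + 1)" and "b = stake n * v (4 * n + 3)"
    and "c = stake n * (k n + 1) * v (4 * n + 4)"
  have step: "S t' = S t + payoff t (v t')" if "t' = Suc t" for t t' using that by (simp add: S_def)
  have payoff: "payoff (4 * n) w = reserve n + stake n * w" "payoff (4 * n + 1) w = 0"
    "payoff (4 * n + 2) w = - int (stake n * w)"
    "payoff (4 * n + 3) w = - int (stake n * (k n + 1) * w)" for w
  proof -
    have "(4 * n + 1) div 4 = n" "(4 * n + 2) div 4 = n" "(4 * n + 3) div 4 = n"
      "(4 * n + 1) mod 4 = 1" "(4 * n + 2) mod 4 = 2" "(4 * n + 3) mod 4 = 3" by presburger+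
    then show "payoff (4 * n) w = reserve n + stake n * w" "payoff (4 * n + 1) w = 0"
      "payoff (4 * n + 2) w = - int (stake n * w)"
      "payoff (4 * n + 3) w = - int (stake n * (k n + 1) * w)"
      unfolding payoff_def Let_def by simp_all
  qed
  have S: "S (4 * n + 1) = S (4 * n) + reserve n + a" "S (4 * n + 2) = S (4 * n + 1)"
    "S (4 * n + 3) = S (4 * n + 2) - b" "S (4 * n + 4) = S (4 * n + 3) - c"
    using step[of "4 * n + 1" "4 * n"] step[of "4 * n + 2" "4 * n + 1"]
      step[of "4 * n + 3" "4 * n + 2"] step[of "4 * n + 4" "4 * n + 3"]
    unfolding payoff a_def b_def c_def by linarith+
  have ab: "a \<le> stake n * k n" "b \<le> stake n * k n"
    using round_values[of n] by (auto simp: a_def b_def)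
  have "v (4 * n + 4) = 0 \<or> v (4 * n + 4) = 1" using round_values[of n] by linarith
  then have c: "c \<le> stake n * k n + stake n" "v (4 * n + 4) \<noteq> 0 \<Longrightarrow> c = stake n * k n + stake n"
    "v (4 * n + 4) = 0 \<Longrightarrow> c = 0"
    by (auto simp: c_def algebra_simps)
  \<comment> \<open>Indices are integers, so an overshoot costs at least one whole stake.\<close>
  have ab': "v (4 * n + 1) < v (4 * n + 3) \<Longrightarrow> a + stake n \<le> b"
    using mult_le_mono2[of "Suc (v (4 * n + 1))" "v (4 * n + 3)" "stake n"]
    by (simp add: a_def b_def)
  have ba': "\<not> v (4 * n + 1) < v (4 * n + 3) \<Longrightarrow> b \<le> a"
    by (simp add: a_def b_def)
  have F1: "fails v n \<Longrightarrow> int a + int (stake n) \<le> int b \<or> int c = int (stake n * k n + stake n)"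
    using ab' c(2) unfolding fails_def of_nat_add[symmetric] of_nat_le_iff of_nat_eq_iff by blast
  have F2: "\<not> fails v n \<Longrightarrow> int b \<le> int a \<and> int c = 0"
    using ba' c(3) unfolding fails_def of_nat_le_iff of_nat_eq_0_iff by blast
  have le: "int a \<le> int (stake n * k n)" "int b \<le> int (stake n * k n)"
    "int c \<le> int (stake n * k n + stake n)"
    using ab c(1) unfolding of_nat_le_iff .
  show ?thesis
    by (rule that[of "int a" "int b" "int c", OF S of_nat_0_le_iff le(1) of_nat_0_le_iff le(2) of_nat_0_le_iff le(3) F1 F2])
qed

lemma abs_sum_le_reserve: "\<bar>S (4 * n)\<bar> \<le> reserve n"
proof (induction n)
  case 0
  then show ?case by (simp add: S_def)
next
  case (Suc n)
  \<comment> \<open>The old total and the compensation account for \<open>2 * reserve n\<close>;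
    prize, payment and penalty add at most \<open>stake n * k n\<close> each, and the penalty one
    further stake.\<close>
  have "reserve (Suc n) = 2 * reserve n + (3 * (stake n * k n) + stake n)"
    by (simp add: stake_def algebra_simps)
  moreover have "S (4 * Suc n) = S (4 * n + 4)" by (simp add: add.commute)
  ultimately show ?case
    using Suc by (cases rule: round_sums[of n]) linarith
qed

text \<open>The old total and the compensation are at most \<open>2 * reserve n\<close>, which the
  stake exceeds by \<open>4 * n + 4\<close>. An overshoot shows after the payment, a penalty at the
  end of the round.\<close>

lemma fails_imp_low:
  assumes "fails v n"
  shows "\<exists>t>n. S t \<le> - int t"
proof -
  have "stake n = 2 * reserve n + (4 * n + 4)" by (simp add: stake_def)
  then have "S (4 * n + 3) \<le> - int (4 * n + 3) \<or> S (4 * n + 4) \<le> - int (4 * n + 4)"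
    using assms abs_sum_le_reserve[of n] by (cases rule: round_sums[of n]) linarith
  moreover have "n < 4 * n + 3" "n < 4 * n + 4" by auto
  ultimately show ?thesis by blast
qed

text \<open>The compensation covers any earlier deficit, and afterwards the prize covers the
  payment.\<close>

lemma not_fails_imp_nonneg:
  assumes "\<not> fails v n"
  shows "0 \<le> S (4 * n + 1)" "0 \<le> S (4 * n + 2)" "0 \<le> S (4 * n + 3)" "0 \<le> S (4 * n + 4)"
  using assms abs_sum_le_reserve[of n] by (cases rule: round_sums[of n]; linarith)+

text \<open>Infinitely many failures give means of at most -1 at arbitrarily late times. Once
  failures have stopped, the sums stay nonnegative after the next compensation.\<close>

lemma liminf_sums_iff:
  "0 \<le> liminf (\<lambda>n. ereal (S n / n)) \<longleftrightarrow> eventually (\<lambda>n. \<not> fails v n) sequentially"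
proof
  assume "0 \<le> liminf (\<lambda>n. ereal (S n / n))"
  then have "ereal (- 1) < liminf (\<lambda>n. ereal (S n / n))"
    by (rule order.strict_trans2[of "ereal (- 1)" 0, rotated]) simp
  then have "eventually (\<lambda>n. ereal (- 1) < ereal (S n / n)) sequentially" by (rule less_LiminfD)
  then obtain N where N: "\<And>n. n \<ge> N \<Longrightarrow> - 1 < S n / n"
    unfolding eventually_sequentially less_ereal.simps by blast
  have "\<not> fails v n" if "n \<ge> N" for n
  proof
    assume "fails v n"
    then obtain t where t: "S t \<le> - int t" "t > n"
      using fails_imp_low by blast
    then have "real_of_int (S t) \<le> - real t" by linarith
    then have "S t / t \<le> - 1" using t by (simp add: divide_le_eq)
    then show False using N[of t] t that by linarith
  qed
  then show "eventually (\<lambda>n. \<not> fails v n) sequentially"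
    unfolding eventually_sequentially by blast
next
  assume "eventually (\<lambda>n. \<not> fails v n) sequentially"
  then obtain N where N: "\<And>n. n \<ge> N \<Longrightarrow> \<not> fails v n"
    unfolding eventually_sequentially by blast
  have "0 \<le> S t" if "t \<ge> 4 * N + 1" for t
  proof -
    have "t > 0" using that by linarith
    then obtain n where n: "t = 4 * n + 1 \<or> t = 4 * n + 2 \<or> t = 4 * n + 3 \<or> t = 4 * n + 4"
      by (rule round_cases)
    then have "n \<ge> N" using that by linarith
    then show ?thesis
      using n not_fails_imp_nonneg[OF N[OF \<open>n \<ge> N\<close>]] by (elim disjE) (simp_all only:)
  qed
  then have "0 \<le> ereal (S t / t)" if "t \<ge> 4 * N + 1" for t
    using that by simp
  then have "eventually (\<lambda>t. 0 \<le> ereal (S t / t)) sequentially"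
    unfolding eventually_sequentially by blast
  then show "0 \<le> liminf (\<lambda>n. ereal (S n / n))"
    by (rule Liminf_bounded)
qed

end

lemma MP_liminf_nonneg_game_iff:
  assumes "\<rho> \<in> runs game init"
  shows "\<rho> \<in> MP_liminf_nonneg game init \<longleftrightarrow>
    eventually (\<lambda>n. \<not> fails (\<lambda>t. val (\<rho> t)) n) sequentially"
proof -
  have *: "fst (prod_decode (\<rho> t)) = t" "val (\<rho> t) \<le> width t" for t
    using runs_game[OF assms, of t] by (auto simp: layer_def)
  have "reward game (\<rho> t, \<rho> (Suc t)) = of_int (payoff t (val (\<rho> (Suc t))))" for t
    by (simp add: game_def *(1))
  then have "mean_payoff game \<rho> = (\<lambda>n. real_of_int (\<Sum>t<n. payoff t (val (\<rho> (Suc t)))) / real n)"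
    by (simp add: fun_eq_iff mean_payoff_def)
  then show ?thesis
    using liminf_sums_iff[of "\<lambda>t. val (\<rho> t)", OF *(2)] assms
    unfolding MP_liminf_nonneg_def by simp
qed

section \<open>The value of the game\<close>

lemma next_state_game:
  assumes "last h = s" "s \<in> layer t"
  shows "next_state game \<sigma> h = (if t mod 4 = 2 then \<sigma> h
    else map_pmf (\<lambda>w. prod_encode (Suc t, w)) (choice_pmf t (val s)))"
  using assms by (simp add: next_state_def controlled_game trans_prob_game)

text \<open>Guesses the index of the current round. At a decision \<open>length h\<close> is
  \<open>4 m + 3\<close>, the time of the successor, and position \<open>length h - 2\<close> is
  time \<open>4 m + 1\<close>, where the index was recorded.\<close>

definition matching :: "nat list \<Rightarrow> nat pmf" where
  "matching h = return_pmf (prod_encode (length h, val (h ! (length h - 2))))"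

lemma matching_strategies: "matching \<in> strategies game init"
  unfolding strategies_def
proof (intro CollectI ballI impI)
  fix h assume h: "h \<in> partial_runs game init" "last h \<in> controlled game"
  note last = last_partial_runs_game[OF h(1)]
  then have "(length h - 1) mod 4 = 2" using controlled_game h(2) by blast
  then have "length h = 4 * ((length h - 1) div 4) + 3"
    using mult_div_mod_eq[of 4 "length h - 1"] by linarith
  then obtain m where m: "length h = 4 * m + 3" by blast
  have "h ! (4 * m + 1) \<in> layer (4 * m + 1)" using partial_runs_game[OF h(1)] m by simp
  \<comment> \<open>The guess is legal because the layers at times \<open>4 m + 1\<close> and
    \<open>4 m + 3\<close> have the same width.\<close>
  then have "val (h ! (4 * m + 1)) \<le> width (4 * m + 3)"
    using val_le_width[of "h ! (4 * m + 1)" "4 * m + 1"] by (simp only: width_round)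
  moreover have "Suc (length h - 1) = 4 * m + 3" using m by linarith
  then have "succs game (last h) = layer (4 * m + 3)"
    using succs_game[OF last] by (simp only:)
  ultimately show "set_pmf (matching h) \<subseteq> succs game (last h)"
    by (simp add: matching_def m layer_iff)
qed

lemma fails_cong: "(\<And>t. t \<le> 4 * n + 4 \<Longrightarrow> v t = v' t) \<Longrightarrow> fails v n \<longleftrightarrow> fails v' n"
  by (simp add: fails_def)

text \<open>Whatever happened before the round, the guess equals the index, so only the risk at the
  drawn index can cause a failure.\<close>

lemma emeasure_matching_fails:
  "emeasure (prefix_pmf game init matching (4 * n + 4)) {h. fails (\<lambda>t. val (h ! t)) n} \<le>
    measure_pmf.expectation (index_pmf (k n)) (risk (k n))"
proof -
  let ?F = "{h. fails (\<lambda>t. val (h ! t)) n}" and ?p = "prefix_pmf game init matching"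
  define ext where "ext h = map_pmf (\<lambda>s. h @ [s]) (next_state game matching h)" for h
  have arith: "(4 * n) mod 4 = 0" "(4 * n + 1) mod 4 = 1" "(4 * n + 2) mod 4 = 2" "(4 * n + 3) mod 4 = 3"
    "(4 * n) div 4 = n" "(4 * n + 3) div 4 = n"
    by presburger+
  have "?p (4 * n + 4) = bind_pmf (?p (4 * n)) (\<lambda>h. bind_pmf (ext h) (\<lambda>h. bind_pmf (ext h) (\<lambda>h. bind_pmf (ext h) ext)))"
    by (simp add: eval_nat_numeral ext_def[abs_def] bind_assoc_pmf)
  also have "emeasure \<dots> ?F \<le> measure_pmf.expectation (index_pmf (k n)) (risk (k n))"
  proof (rule emeasure_bind_pmf_le)
    fix h assume h: "h \<in> set_pmf (?p (4 * n))"
    have len: "length h = 4 * n + 1" using length_prefix_pmf[OF h] by simp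
    have "4 * n + 1 = length h + 0" "4 * n + 3 = length h + 2" "4 * n + 4 = length h + 3"
      by (simp_all add: len)
    then have idx: "(h @ xs) ! (4 * n + 1) = xs ! 0" "(h @ xs) ! (4 * n + 3) = xs ! 2"
      "(h @ xs) ! (4 * n + 4) = xs ! 3" for xs
      by (simp_all only: nth_append_length_plus)
    have last: "last h \<in> layer (4 * n)"
      using last_partial_runs_game set_prefix_pmf[OF is_mdp_game initial_game matching_strategies h] len
      by fastforce
    have round: "bind_pmf (ext h) (\<lambda>h. bind_pmf (ext h) (\<lambda>h. bind_pmf (ext h) ext)) =
        bind_pmf (index_pmf (k n)) (\<lambda>i. map_pmf (\<lambda>x. h @ [prod_encode (4 * n + 1, i),
          prod_encode (4 * n + 2, 0), prod_encode (4 * n + 3, i), prod_encode (4 * n + 4, of_bool x)])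
          (bernoulli_pmf (risk (k n) i)))"
    proof -
      have e0: "ext h = map_pmf (\<lambda>i. h @ [prod_encode (4 * n + 1, i)]) (index_pmf (k n))"
        using next_state_game[OF refl last] arith by (simp add: ext_def choice_pmf_def pmf.map_comp o_def)
      have "bind_pmf (ext (h @ [prod_encode (4 * n + 1, i)])) (\<lambda>h. bind_pmf (ext h) ext) =
          map_pmf (\<lambda>x. h @ [prod_encode (4 * n + 1, i),
          prod_encode (4 * n + 2, 0), prod_encode (4 * n + 3, i), prod_encode (4 * n + 4, of_bool x)])
          (bernoulli_pmf (risk (k n) i))" if "i \<in> set_pmf (index_pmf (k n))" for i
      proof -
        have i: "i \<le> k n" using that by (simp add: set_index_pmf)
        have "prod_encode (4 * n + 1, i) \<in> layer (4 * n + 1)"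
          "prod_encode (4 * n + 2, 0) \<in> layer (4 * n + 2)"
          "prod_encode (4 * n + 3, i) \<in> layer (4 * n + 3)"
          using i unfolding layer_iff width_round by auto
        note l = next_state_game[where h = "h @ [prod_encode (4 * n + 1, i)]", OF _ this(1)]
          next_state_game[where h = "h @ [prod_encode (4 * n + 1, i), prod_encode (4 * n + 2, 0)]", OF _ this(2)]
          next_state_game[where h = "h @ [prod_encode (4 * n + 1, i), prod_encode (4 * n + 2, 0),
            prod_encode (4 * n + 3, i)]", OF _ this(3)]
        have e1: "ext (h @ [prod_encode (4 * n + 1, i)]) =
            return_pmf (h @ [prod_encode (4 * n + 1, i), prod_encode (4 * n + 2, 0)])"
          using l(1) by (simp add: ext_def choice_pmf_def arith)
        have e2: "ext (h @ [prod_encode (4 * n + 1, i), prod_encode (4 * n + 2, 0)]) =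
            return_pmf (h @ [prod_encode (4 * n + 1, i), prod_encode (4 * n + 2, 0), prod_encode (4 * n + 3, i)])"
        proof -
          have "matching (h @ [prod_encode (4 * n + 1, i), prod_encode (4 * n + 2, 0)]) =
              return_pmf (prod_encode (length h + 2, i))"
            by (simp add: matching_def)
          also have "length h + 2 = 4 * n + 3" by (simp add: len)
          finally show ?thesis using l(2) arith(3) by (simp add: ext_def)
        qed
        have e3: "ext (h @ [prod_encode (4 * n + 1, i), prod_encode (4 * n + 2, 0), prod_encode (4 * n + 3, i)]) =
            map_pmf (\<lambda>x. h @ [prod_encode (4 * n + 1, i),
            prod_encode (4 * n + 2, 0), prod_encode (4 * n + 3, i), prod_encode (4 * n + 4, of_bool x)])
            (bernoulli_pmf (risk (k n) i))"
          using l(3) by (simp add: ext_def choice_pmf_def arith pmf.map_comp o_def add.commute[of "4 * n" 4])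
        show ?thesis by (simp only: e1 e2 e3 bind_return_pmf)
      qed
      then show ?thesis
        unfolding e0 bind_map_pmf by (intro bind_pmf_cong refl)
    qed
    have "emeasure (bind_pmf (ext h) (\<lambda>h. bind_pmf (ext h) (\<lambda>h. bind_pmf (ext h) ext))) ?F =
        (\<integral>\<^sup>+i. ennreal (risk (k n) i) \<partial>index_pmf (k n))"
    proof -
      have "(\<lambda>x. h @ [prod_encode (4 * n + 1, i), prod_encode (4 * n + 2, 0), prod_encode (4 * n + 3, i),
          prod_encode (4 * n + 4, of_bool x)]) -` ?F = {True}" for i
        unfolding fails_def vimage_def mem_Collect_eq idx by auto
      then show ?thesis
        unfolding round using risk_bounds by (simp add: emeasure_pmf_single less_imp_le)
    qed
    also have "\<dots> = measure_pmf.expectation (index_pmf (k n)) (risk (k n))"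
      using risk_bounds
      by (intro nn_integral_eq_integral measure_pmf.integrable_const_bound[where B = 1])
        (auto simp: less_imp_le)
    finally show "emeasure (bind_pmf (ext h) (\<lambda>h. bind_pmf (ext h) (\<lambda>h. bind_pmf (ext h) ext))) ?F \<le>
        measure_pmf.expectation (index_pmf (k n)) (risk (k n))" by simp
  qed
  finally show ?thesis .
qed

text \<open>By the first Borel-Cantelli lemma, summable failure probabilities leave only finitely
  many failures almost surely.\<close>

lemma prob_matching:
  assumes "summable (\<lambda>n. measure_pmf.expectation (index_pmf (k n)) (risk (k n)))"
  shows "prob_of game init matching (MP_liminf_nonneg game init) = 1"
proof -
  let ?R = "run_measure game init matching"
  interpret R: prob_space ?R by (rule prob_space_run_measure)
  define B where "B n = {\<rho> :: nat \<Rightarrow> nat. fails (\<lambda>t. val (\<rho> t)) n}" for n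
  have B: "B n = {\<rho>. map \<rho> [0..<Suc (4 * n + 4)] \<in> {h. fails (\<lambda>t. val (h ! t)) n}}" for n
    unfolding B_def mem_Collect_eq
    by (intro Collect_cong fails_cong) (auto simp del: upt_Suc)
  have meas: "measure ?R (B n) \<le> measure_pmf.expectation (index_pmf (k n)) (risk (k n))" for n
  proof -
    have "0 \<le> measure_pmf.expectation (index_pmf (k n)) (risk (k n))"
      by (simp add: expected_risk)
    then show ?thesis
      using emeasure_matching_fails[of n]
      unfolding B measure_prefix by (simp add: measure_pmf.emeasure_eq_measure)
  qed
  have "AE \<rho> in ?R. eventually (\<lambda>n. \<rho> \<in> space ?R - B n) sequentially"
  proof (rule borel_cantelli_AE1)
    show "B n \<in> sets ?R" for n unfolding B by (rule sets_prefix)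
    show "summable (\<lambda>n. measure ?R (B n))"
      by (rule summable_comparison_test'[OF assms]) (use meas in simp)
  qed (simp add: less_top[symmetric])
  then have "AE \<rho> in ?R. \<rho> \<in> MP_liminf_nonneg game init"
    using AE_runs[OF is_mdp_game initial_game matching_strategies]
  proof eventually_elim
    case (elim \<rho>)
    then show ?case by (auto simp: MP_liminf_nonneg_game_iff B_def elim: eventually_mono)
  qed
  then show ?thesis
    unfolding prob_of_def using R.prob_eq_1[OF sets_MP_liminf_nonneg] by simp
qed

lemma mdp_value_game:
  assumes "summable (\<lambda>n. measure_pmf.expectation (index_pmf (k n)) (risk (k n)))"
  shows "mdp_value game init (MP_liminf_nonneg game init) = 1"
  unfolding mdp_value_def
proof (rule cSup_eq_maximum)
  show "1 \<in> (\<lambda>\<sigma>. prob_of game init \<sigma> (MP_liminf_nonneg game init)) `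
      strategies game init"
    using prob_matching[OF assms] matching_strategies by (intro image_eqI[of _ _ matching]) auto
qed (auto simp: prob_of_def intro!: prob_space.prob_le_1[OF prob_space_run_measure])

section \<open>Bounded memory\<close>

text \<open>\<open>A t\<close> contains the memory modes possible at time \<open>t\<close>, which covers a step counter together with
  boundedly many further modes.\<close>

context
  fixes Mem :: "'m set" and A :: "nat \<Rightarrow> 'm set" and u :: "'m \<times> nat \<Rightarrow> ('m \<times> nat) pmf"
    and m0 :: 'm and K :: nat
  assumes update: "update_function game Mem u"
    and A: "A t \<subseteq> Mem" "finite (A t)" "card (A t) \<le> K"
    and step: "m \<in> A t \<Longrightarrow> s \<in> layer t \<Longrightarrow> set_pmf (u (m, s)) \<subseteq> A (Suc t) \<times> layer (Suc t)"
    and m0: "m0 \<in> A 0"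
begin

definition ext :: "('m \<times> nat) list \<Rightarrow> ('m \<times> nat) list pmf" where
  "ext w = map_pmf (\<lambda>y. w @ [y]) (u (last w))"

text \<open>At random states the state marginal of an update is prescribed, so memory cannot
  influence the drawn value.\<close>

lemma next_value_pmf:
  assumes "y \<in> A t \<times> layer t" "t mod 4 \<noteq> 2"
  shows "map_pmf (\<lambda>y. val (snd y)) (u y) = choice_pmf t (val (snd y))"
proof -
  obtain m s where y: "y = (m, s)" "m \<in> Mem" "s \<in> layer t" using assms A by auto
  then have "map_pmf snd (u y) = trans_prob game s"
    using update random_game[of s t] assms(2) unfolding update_function_def by blast
  then have "map_pmf val (map_pmf snd (u y)) = map_pmf val (map_pmf (\<lambda>w. prod_encode (Suc t, w)) (choice_pmf t (val s)))"
    using trans_prob_game[OF y(3)] by simp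
  then show ?thesis using y(1) by (simp add: pmf.map_comp o_def)
qed

text \<open>The guessing layer has a single state, so only the mode carries information on the
  index. Replacing the mode by the best one for each index gives an upper bound to which
  \<open>bounded_memory_loss\<close> applies, uniformly in the history \<open>w\<close>.\<close>

lemma emeasure_round_succeeds:
  assumes w: "last w \<in> A (4 * n) \<times> layer (4 * n)" "length w = 4 * n + 1" and K: "K \<le> k n"
  shows "emeasure (measure_pmf (bind_pmf (ext w) (\<lambda>w. bind_pmf (ext w) (\<lambda>w. bind_pmf (ext w) ext))))
      {w. \<not> fails (\<lambda>t. val (snd (w ! t))) n} \<le> ennreal (1 - 1 / real (weight_sum (k n)))"
proof -
  let ?F = "{w. \<not> fails (\<lambda>t. val (snd (w ! t))) n}"
  let ?d = "pmf (index_pmf (k n))" and ?v = "\<lambda>y. val (snd y)"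
  \<comment> \<open>\<open>g i j\<close> is the probability of surviving the round with index
    \<open>i\<close> and guess \<open>j\<close>; \<open>E m i\<close> averages it over the guess
    made from mode \<open>m\<close>.\<close>
  define g where "g i j = (if j \<le> i then 1 - risk (k n) j else 0)" for i j :: nat
  define E where "E m i = measure_pmf.expectation (map_pmf ?v (u (m, prod_encode (4 * n + 2, 0)))) (g i)" for m i
  have g: "0 \<le> g i j" "g i j \<le> 1" for i j
    using risk_bounds[of "k n" j] by (auto simp: g_def)
  have int: "integrable (measure_pmf q) (g i)" for q i
    by (rule measure_pmf.integrable_const_bound[where B = 1]) (use g in auto)
  have arith: "(4 * n) mod 4 = 0" "(4 * n + 1) mod 4 = 1" "(4 * n + 3) mod 4 = 3"
    "(4 * n) div 4 = n" "(4 * n + 3) div 4 = n"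
    by presburger+
  have "4 * n + 1 = length w + 0" "4 * n + 3 = length w + 2" "4 * n + 4 = length w + 3"
    by (simp_all add: w(2))
  then have idx: "(w @ xs) ! (4 * n + 1) = xs ! 0" "(w @ xs) ! (4 * n + 3) = xs ! 2"
    "(w @ xs) ! (4 * n + 4) = xs ! 3" for xs
    by (simp_all only: nth_append_length_plus)
  have Suc_t: "Suc (4 * n) = 4 * n + 1" "Suc (4 * n + 1) = 4 * n + 2" "Suc (4 * n + 2) = 4 * n + 3"
    by simp_all
  have next_range: "y' \<in> A (Suc t) \<times> layer (Suc t)" if "y \<in> A t \<times> layer t" "y' \<in> set_pmf (u y)" for y y' t
    using step[of "fst y" t "snd y"] that by auto
  have "A (4 * n + 2) \<noteq> {}"
  proof -
    obtain y1 where y1: "y1 \<in> set_pmf (u (last w))" using set_pmf_not_empty by fast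
    obtain y2 where y2: "y2 \<in> set_pmf (u y1)" using set_pmf_not_empty by fast
    show ?thesis using next_range[OF next_range[OF w(1) y1] y2] unfolding Suc_t by auto
  qed
  \<comment> \<open>Only finitely many modes are possible, so for each index some mode maximizes
    \<open>E\<close>; \<open>f\<close> collects these.\<close>
  then have "\<exists>m \<in> A (4 * n + 2). \<forall>m' \<in> A (4 * n + 2). E m' i \<le> E m i" for i
  proof -
    let ?S = "(\<lambda>m. E m i) ` A (4 * n + 2)"
    have "Max ?S \<in> ?S" using \<open>A (4 * n + 2) \<noteq> {}\<close> A(2) by (intro Max_in) auto
    then obtain m where "m \<in> A (4 * n + 2)" "E m i = Max ?S" by auto
    moreover have "E m' i \<le> Max ?S" if "m' \<in> A (4 * n + 2)" for m'
      using A(2) that by (intro Max_ge) auto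
    ultimately show ?thesis by metis
  qed
  then obtain f where f: "\<And>i. f i \<in> A (4 * n + 2)" "\<And>i m. m \<in> A (4 * n + 2) \<Longrightarrow> E m i \<le> E (f i) i"
    by metis
  have last_step: "emeasure (u y3) {y4. w @ [y1, y2, y3, y4] \<in> ?F} = ennreal (g (?v y1) (?v y3))"
    if y3: "y3 \<in> A (4 * n + 3) \<times> layer (4 * n + 3)" for y1 y2 y3
  proof -
    have "{y4. w @ [y1, y2, y3, y4] \<in> ?F} = (if ?v y3 \<le> ?v y1 then ?v -` {0} else {})"
      unfolding fails_def mem_Collect_eq idx by auto
    moreover have "emeasure (u y3) (?v -` {0}) = ennreal (1 - risk (k n) (?v y3))"
    proof -
      have "emeasure (u y3) (?v -` {0}) = emeasure (choice_pmf (4 * n + 3) (?v y3)) {0}"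
        using arg_cong[OF next_value_pmf[OF y3], of "\<lambda>p. emeasure (measure_pmf p) {0}"] arith
        by simp
      also have "\<dots> = emeasure (bernoulli_pmf (risk (k n) (?v y3))) {False}"
        unfolding choice_pmf_def arith
        by (auto simp: intro!: arg_cong[where f = "emeasure (measure_pmf (bernoulli_pmf (risk (k n) (val (snd y3)))))"])
      finally show ?thesis
        using risk_bounds[of "k n" "?v y3"] by (simp add: emeasure_pmf_single less_imp_le)
    qed
    ultimately show ?thesis by (simp add: g_def)
  qed
  have guess_step: "(\<integral>\<^sup>+y3. ennreal (g i (?v y3)) \<partial>u y2) \<le> ennreal (E (f i) i)"
    if y2: "y2 \<in> A (4 * n + 2) \<times> layer (4 * n + 2)" for i y2
  proof -
    have "snd y2 = prod_encode (4 * n + 2, 0)"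
      using y2 width_round(3)[of n] by (auto simp: layer_def)
    then have "(fst y2, prod_encode (4 * n + 2, 0)) = y2" by (cases y2) simp
    then have "(\<integral>\<^sup>+y3. ennreal (g i (?v y3)) \<partial>u y2) =
        (\<integral>\<^sup>+j. ennreal (g i j) \<partial>map_pmf ?v (u (fst y2, prod_encode (4 * n + 2, 0))))"
      by (simp only: nn_integral_map_pmf)
    also have "\<dots> = ennreal (E (fst y2) i)"
      unfolding E_def by (intro nn_integral_eq_integral int) (simp add: g)
    also have "\<dots> \<le> ennreal (E (f i) i)"
      using f(2)[of "fst y2" i] y2 by (intro ennreal_leI) auto
    finally show ?thesis .
  qed
  have E: "0 \<le> E m i" "E m i \<le> 1" for m i
    unfolding E_def
    by (auto intro!: integral_nonneg measure_pmf.integral_le_const int simp: g simp del: integral_map_pmf)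
  have "emeasure (measure_pmf (bind_pmf (ext w) (\<lambda>w. bind_pmf (ext w) (\<lambda>w. bind_pmf (ext w) ext)))) ?F =
      (\<integral>\<^sup>+y1. \<integral>\<^sup>+y2. \<integral>\<^sup>+y3. emeasure (u y3) {y4. w @ [y1, y2, y3, y4] \<in> ?F} \<partial>u y2 \<partial>u y1 \<partial>u (last w))"
    by (simp add: ext_def vimage_def)
  also have "\<dots> \<le> (\<integral>\<^sup>+y1. ennreal (E (f (?v y1)) (?v y1)) \<partial>u (last w))"
  proof (intro nn_integral_mono_AE AE_pmfI)
    fix y1 assume "y1 \<in> set_pmf (u (last w))"
    note y1 = next_range[OF w(1) this, unfolded Suc_t]
    have "(\<integral>\<^sup>+y2. \<integral>\<^sup>+y3. emeasure (u y3) {y4. w @ [y1, y2, y3, y4] \<in> ?F} \<partial>u y2 \<partial>u y1) \<le>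
        (\<integral>\<^sup>+y2. ennreal (E (f (?v y1)) (?v y1)) \<partial>u y1)"
    proof (intro nn_integral_mono_AE AE_pmfI)
      fix y2 assume "y2 \<in> set_pmf (u y1)"
      note y2 = next_range[OF y1 this, unfolded Suc_t]
      have "(\<integral>\<^sup>+y3. emeasure (u y3) {y4. w @ [y1, y2, y3, y4] \<in> ?F} \<partial>u y2) =
          (\<integral>\<^sup>+y3. ennreal (g (?v y1) (?v y3)) \<partial>u y2)"
        using next_range[OF y2, unfolded Suc_t] last_step
        by (intro nn_integral_cong_AE AE_pmfI) blast
      also have "\<dots> \<le> ennreal (E (f (?v y1)) (?v y1))" by (rule guess_step[OF y2])
      finally show "(\<integral>\<^sup>+y3. emeasure (u y3) {y4. w @ [y1, y2, y3, y4] \<in> ?F} \<partial>u y2) \<le>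
          ennreal (E (f (?v y1)) (?v y1))" .
    qed
    then show "(\<integral>\<^sup>+y2. \<integral>\<^sup>+y3. emeasure (u y3) {y4. w @ [y1, y2, y3, y4] \<in> ?F} \<partial>u y2 \<partial>u y1) \<le>
        ennreal (E (f (?v y1)) (?v y1))"
      by (simp add: measure_pmf.emeasure_space_1)
  qed
  also have "\<dots> = (\<integral>\<^sup>+i. ennreal (E (f i) i) \<partial>map_pmf ?v (u (last w)))"
    by simp
  also have "map_pmf ?v (u (last w)) = index_pmf (k n)"
    using next_value_pmf[OF w(1)] arith by (simp add: choice_pmf_def)
  also have "(\<integral>\<^sup>+i. ennreal (E (f i) i) \<partial>index_pmf (k n)) =
      ennreal (measure_pmf.expectation (index_pmf (k n)) (\<lambda>i. E (f i) i))"
    by (intro nn_integral_eq_integral measure_pmf.integrable_const_bound[where B = 1]) (simp_all add: E)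
  also have "measure_pmf.expectation (index_pmf (k n)) (\<lambda>i. E (f i) i) = (\<Sum>i\<le>k n. E (f i) i * ?d i)"
    by (rule integral_measure_pmf_real) (auto simp: set_index_pmf)
  also have "\<dots> \<le> 1 - 1 / real (weight_sum (k n))"
    using bounded_memory_loss[of "A (4 * n + 2)" "k n" f
        "\<lambda>m. map_pmf ?v (u (m, prod_encode (4 * n + 2, 0)))"] A K f(1) order_trans[OF A(3) K]
    by (simp add: E_def g_def[abs_def] mult.commute image_subset_iff del: integral_map_pmf)
  finally show ?thesis by (simp add: ennreal_leI)
qed

text \<open>The bound for one round holds conditionally on every past, so the factors multiply
  without independence of the rounds. Rounds with \<open>k l < K\<close> get the trivial factor
  1.\<close>

lemma emeasure_rounds_succeed:
  "emeasure (measure_pmf (chain_prefix u (m0, init) (4 * n)))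
      {w. \<forall>l \<in> {a..<n}. \<not> fails (\<lambda>t. val (snd (w ! t))) l} \<le>
    ennreal (\<Prod>l \<in> {a..<n}. 1 - (if K \<le> k l then 1 / real (weight_sum (k l)) else 0))"
proof (induction n)
  case (Suc n)
  let ?C = "chain_prefix u (m0, init)"
  let ?G = "\<lambda>n. {w. \<forall>l \<in> {a..<n}. \<not> fails (\<lambda>t. val (snd (w ! t))) l}"
  define c where "c l = (if K \<le> k l then 1 / real (weight_sum (k l)) else 0)" for l
  have c: "0 \<le> c l" "c l \<le> 1" for l
    using weight_sum_pos[of "k l"] by (auto simp: c_def)
  define ext4 where "ext4 w = bind_pmf (ext w) (\<lambda>w. bind_pmf (ext w) (\<lambda>w. bind_pmf (ext w) ext))" for w
  show ?case
  proof (cases "a \<le> n")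
    case False
    then show ?thesis by simp
  next
    case True
    have C_Suc: "?C (4 * Suc n) = bind_pmf (?C (4 * n)) ext4"
    proof -
      have "?C (Suc t) = bind_pmf (?C t) ext" for t by (simp add: ext_def[abs_def])
      then have "?C (Suc (Suc (Suc (Suc (4 * n))))) = bind_pmf (?C (4 * n)) ext4"
        by (simp only: bind_assoc_pmf ext4_def[abs_def])
      moreover have "4 * Suc n = Suc (Suc (Suc (Suc (4 * n))))" by simp
      ultimately show ?thesis by (simp only:)
    qed
    have "emeasure (ext4 w) (?G (Suc n)) \<le> ennreal (1 - c n) * indicator (?G n) w"
      if w: "w \<in> set_pmf (?C (4 * n))" for w
    proof -
      have len: "length w = 4 * n + 1" using length_chain_prefix[OF w] by simp
      show ?thesis
      proof (cases "w \<in> ?G n")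
        case G: True
        have "last w \<in> A (4 * n) \<times> layer (4 * n)"
          using step m0 w by (intro chain_prefix_invariant[of A layer u]) (auto simp: layer_iff)
        then have "emeasure (ext4 w) {w. \<not> fails (\<lambda>t. val (snd (w ! t))) n} \<le> ennreal (1 - c n)"
          using emeasure_round_succeeds[of w n] len
          by (simp add: c_def ext4_def measure_pmf.emeasure_le_1 del: emeasure_bind_pmf)
        moreover have "emeasure (ext4 w) (?G (Suc n)) \<le> emeasure (ext4 w) {w. \<not> fails (\<lambda>t. val (snd (w ! t))) n}"
          using True by (intro emeasure_mono) auto
        ultimately show ?thesis using G by simp
      next
        case False
        \<comment> \<open>A failure before round \<open>n\<close> is determined by the first
          \<open>4 * n + 1\<close> states, so extending \<open>w\<close> cannot undo it.\<close>
        then obtain l where l: "l \<in> {a..<n}" "fails (\<lambda>t. val (snd (w ! t))) l" by auto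
        have "w' \<notin> ?G (Suc n)" if "w' \<in> set_pmf (ext4 w)" for w'
        proof -
          have "\<exists>ys. w' = w @ ys" using that by (auto simp: ext4_def ext_def)
          then obtain ys where "w' = w @ ys" by blast
          then have "fails (\<lambda>t. val (snd (w' ! t))) l \<longleftrightarrow> fails (\<lambda>t. val (snd (w ! t))) l"
            using l(1) len by (intro fails_cong) (simp add: nth_append)
          then show ?thesis using l by auto
        qed
        then have "?G (Suc n) \<inter> set_pmf (ext4 w) = {}" by blast
        then have "emeasure (ext4 w) (?G (Suc n)) = 0"
          using emeasure_Int_set_pmf[of "ext4 w" "?G (Suc n)"] by simp
        then show ?thesis by simp
      qed
    qed
    then have "emeasure (?C (4 * Suc n)) (?G (Suc n)) \<le> (\<integral>\<^sup>+w. ennreal (1 - c n) * indicator (?G n) w \<partial>?C (4 * n))"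
      unfolding C_Suc emeasure_bind_pmf by (intro nn_integral_mono_AE AE_pmfI)
    also have "\<dots> = ennreal (1 - c n) * emeasure (?C (4 * n)) (?G n)"
      by (simp add: nn_integral_cmult)
    also have "\<dots> \<le> ennreal (1 - c n) * ennreal (\<Prod>l \<in> {a..<n}. 1 - c l)"
      using Suc.IH by (intro mult_left_mono) (simp_all add: c_def)
    also have "\<dots> = ennreal (\<Prod>l \<in> {a..<Suc n}. 1 - c l)"
      using True c by (simp add: ennreal_mult[symmetric] prod_nonneg mult.commute)
    finally show ?thesis by (simp add: c_def)
  qed
qed simp

text \<open>A run in the objective has no failure from some round \<open>a\<close> on. Each of these
  countably many events is null: the product bound and \<open>1 - x \<le> exp (- x)\<close> leave
  the exponential of a divergent negative sum.\<close>

lemma prob_bounded_memory: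
  assumes \<sigma>: "\<sigma> \<in> strategies game init" "implements game init u m0 \<sigma>"
    and div: "\<not> summable (\<lambda>n. if K \<le> k n then 1 / real (weight_sum (k n)) else 0)"
  shows "prob_of game init \<sigma> (MP_liminf_nonneg game init) = 0"
proof -
  let ?R = "run_measure game init \<sigma>"
  interpret R: prob_space ?R by (rule prob_space_run_measure)
  define c where "c l = (if K \<le> k l then 1 / real (weight_sum (k l)) else 0)" for l
  have c: "0 \<le> c l" "c l \<le> 1" for l
    using weight_sum_pos[of "k l"] by (auto simp: c_def)
  define N where "N a n = {\<rho> :: nat \<Rightarrow> nat. \<forall>l \<in> {a..<n}. \<not> fails (\<lambda>t. val (\<rho> t)) l}" for a n
  have N: "N a n = {\<rho>. map \<rho> [0..<Suc (4 * n)] \<in> {h. \<forall>l \<in> {a..<n}. \<not> fails (\<lambda>t. val (h ! t)) l}}" for a n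
    unfolding N_def mem_Collect_eq
    by (intro Collect_cong ball_cong refl arg_cong[of _ _ Not] fails_cong) (auto simp del: upt_Suc)
  have sets_N: "N a n \<in> sets ?R" for a n unfolding N by (rule sets_prefix)
  have measure_N: "measure ?R (N a n) \<le> exp (- (\<Sum>l \<in> {a..<n}. c l))" for a n
  proof -
    let ?C = "chain_prefix u (m0, init) (4 * n)"
    let ?G = "{w. \<forall>l \<in> {a..<n}. \<not> fails (\<lambda>t. val (snd (w ! t))) l}"
    have "m0 \<in> Mem" using m0 A(1) by blast
    then have "measure ?R (N a n) =
        measure_pmf.prob ?C (map snd -` {h. \<forall>l \<in> {a..<n}. \<not> fails (\<lambda>t. val (h ! t)) l})"
      unfolding N measure_prefix
      using prefix_pmf_implements[OF is_mdp_game initial_game \<sigma>(1) update _ \<sigma>(2)] by simp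
    also have "\<dots> = measure_pmf.prob ?C ?G"
    \<comment> \<open>Moving \<open>snd\<close> past \<open>!\<close> requires an index within the
      list, hence the comparison only almost everywhere.\<close>
    proof (rule measure_pmf.finite_measure_eq_AE)
      have "fails (\<lambda>t. val (map snd w ! t)) l \<longleftrightarrow> fails (\<lambda>t. val (snd (w ! t))) l"
        if "w \<in> set_pmf ?C" "l < n" for w l
        using length_chain_prefix[OF that(1)] that(2) by (intro fails_cong) simp
      then show "AE w in ?C. (w \<in> map snd -` {h. \<forall>l \<in> {a..<n}. \<not> fails (\<lambda>t. val (h ! t)) l}) = (w \<in> ?G)"
        by (intro AE_pmfI) auto
    qed auto
    also have "\<dots> \<le> (\<Prod>l \<in> {a..<n}. 1 - c l)"
      using emeasure_rounds_succeed[where a = a and n = n] c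
      by (simp add: c_def[symmetric] measure_pmf.emeasure_eq_measure prod_nonneg)
    also have "\<dots> \<le> (\<Prod>l \<in> {a..<n}. exp (- c l))"
      using c exp_ge_add_one_self[of "- c _"] by (intro prod_mono) auto
    also have "\<dots> = exp (- (\<Sum>l \<in> {a..<n}. c l))"
      by (simp add: exp_sum sum_negf[symmetric])
    finally show ?thesis .
  qed
  have "measure ?R (\<Inter>n. N a n) = 0" for a
  proof (rule ccontr)
    let ?p = "measure ?R (\<Inter>n. N a n)"
    assume "?p \<noteq> 0"
    then have "?p > 0" by (simp add: zero_less_measure_iff)
    \<comment> \<open>A positive probability \<open>?p\<close> would bound the partial sums of the
      nonnegative \<open>c\<close> and make it summable.\<close>
    have "(\<Sum>l<n. c (l + a)) \<le> - ln ?p" for n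
    proof -
      have "?p \<le> measure ?R (N a (n + a))"
        using sets_N by (intro R.finite_measure_mono) auto
      also have "\<dots> \<le> exp (- (\<Sum>l \<in> {a..<n + a}. c l))" by (rule measure_N)
      finally have "ln ?p \<le> ln (exp (- (\<Sum>l \<in> {a..<n + a}. c l)))"
        using \<open>?p > 0\<close> by (simp only: ln_le_cancel_iff exp_gt_zero)
      then show ?thesis
        using sum.shift_bounds_nat_ivl[of c 0 a n] by (simp add: atLeast0LessThan)
    qed
    then have "summable (\<lambda>l. c (l + a))"
      using c by (intro summableI_nonneg_bounded[where x = "- ln ?p"]) auto
    then have "summable c" by (simp add: summable_iff_shift)
    then show False using div by (simp add: c_def[abs_def])
  qed
  then have "AE \<rho> in ?R. \<rho> \<notin> (\<Inter>n. N a n)" for a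
    using sets_N by (subst R.prob_eq_0[symmetric]) auto
  then have "AE \<rho> in ?R. \<forall>a. \<rho> \<notin> (\<Inter>n. N a n)"
    by (simp add: AE_all_countable)
  then have "AE \<rho> in ?R. \<rho> \<notin> MP_liminf_nonneg game init"
    using AE_runs[OF is_mdp_game initial_game \<sigma>(1)]
  proof eventually_elim
    case (elim \<rho>)
    then show ?case
      by (auto simp: MP_liminf_nonneg_game_iff N_def eventually_sequentially) fastforce
  qed
  then show ?thesis
    unfolding prob_of_def using R.prob_eq_0[OF sets_MP_liminf_nonneg] by simp
qed

end

section \<open>Finite memory, and bits with a step counter, as instances\<close>

lemma prob_FR_strategy:
  assumes div: "\<And>K. \<not> summable (\<lambda>n. if K \<le> k n then 1 / real (weight_sum (k n)) else 0)"
    and \<sigma>: "FR_strategy game init \<sigma>"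
  shows "prob_of game init \<sigma> (MP_liminf_nonneg game init) = 0"
proof -
  obtain Mem :: "nat set" and u m0 where u: "m0 \<in> Mem" "finite Mem" "update_function game Mem u"
    "implements game init u m0 \<sigma>"
    using \<sigma> unfolding FR_strategy_def by blast
  show ?thesis
  proof (rule prob_bounded_memory[where A = "\<lambda>_. Mem" and K = "card Mem"])
    show "set_pmf (u (m, s)) \<subseteq> Mem \<times> layer (Suc t)" if "m \<in> Mem" "s \<in> layer t" for m s t
      using update_function_succs[OF is_mdp_game u(3) that(1), of s] succs_game[OF that(2)] that(2)
      by (auto simp: states_game)
  qed (use u div \<sigma> in \<open>auto simp: FR_strategy_def\<close>)
qed

lemma prob_k_bit_Markov_strategy:
  assumes div: "\<And>K. \<not> summable (\<lambda>n. if K \<le> k n then 1 / real (weight_sum (k n)) else 0)"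
    and \<sigma>: "k_bit_Markov_strategy b game init \<sigma>"
  shows "prob_of game init \<sigma> (MP_liminf_nonneg game init) = 0"
proof -
  obtain u b0 where u: "(0, b0) \<in> k_bit_modes b" "update_function game (k_bit_modes b) u"
    "counts_steps game b u" "implements game init u (0, b0) \<sigma>"
    using \<sigma> unfolding k_bit_Markov_strategy_def by blast
  \<comment> \<open>At time \<open>t\<close> the counter equals \<open>t\<close>, so only the bits
    vary: there are infinitely many modes in total, but a fixed finite number at each time.\<close>
  let ?A = "\<lambda>t. {t} \<times> {bs :: bool list. length bs = b}"
  have fin: "finite {bs :: bool list. length bs = b}"
    using finite_lists_length_eq[of "UNIV :: bool set" b] by simp
  show ?thesis
  proof (rule prob_bounded_memory[where A = ?A and K = "card {bs :: bool list. length bs = b}"])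
    fix t m s assume m: "m \<in> ?A t" and s: "s \<in> layer t"
    have "set_pmf (u (m, s)) \<subseteq> k_bit_modes b \<times> layer (Suc t)"
      using update_function_succs[OF is_mdp_game u(2), of m s] succs_game[OF s] m s
      by (auto simp: states_game k_bit_modes_def)
    moreover have "fst (fst y) = Suc t" if "y \<in> set_pmf (u (m, s))" for y
      using u(3) m s that unfolding counts_steps_def states_game by fastforce
    ultimately show "set_pmf (u (m, s)) \<subseteq> ?A (Suc t) \<times> layer (Suc t)"
      by (fastforce simp: k_bit_modes_def)
  qed (use u div \<sigma> fin in \<open>auto simp: k_bit_Markov_strategy_def k_bit_modes_def card_cartesian_product\<close>)
qed

end

theorem theorem4p12:
  shows "\<exists>(M :: nat mdp) s0.
    is_mdp M \<and> s0 \<in> states M \<and>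
    finitely_branching M \<and> acyclic (transitions M) \<and> integer_rewards M \<and> step_counter_implicit M s0 \<and>
    mdp_value M s0 (MP_liminf_nonneg M s0) = 1 \<and>
    (\<forall>\<sigma>. FR_strategy M s0 \<sigma> \<longrightarrow> prob_of M s0 \<sigma> (MP_liminf_nonneg M s0) = 0) \<and>
    (\<forall>k (\<epsilon> :: real). \<epsilon> < 1 \<longrightarrow>
       \<not> (\<exists>\<sigma>. k_bit_Markov_strategy k M s0 \<sigma> \<and> eps_optimal M s0 (MP_liminf_nonneg M s0) \<epsilon> \<sigma>))"
proof -
  obtain k :: "nat \<Rightarrow> nat"
    where conv: "summable (\<lambda>n. measure_pmf.expectation (index_pmf (k n)) (risk (k n)))"
      and div: "\<And>K. \<not> summable (\<lambda>n. if K \<le> k n then 1 / real (weight_sum (k n)) else 0)"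
    using exists_schedule by blast
  let ?M = "game k" and ?s = "init"
  note val_1 = mdp_value_game[OF conv]
  \<comment> \<open>Optimality up to \<epsilon> would require probability at least
    \<open>1 - \<epsilon> > 0\<close>, whereas the strategy attains 0.\<close>
  have "\<not> (k_bit_Markov_strategy b ?M ?s \<sigma> \<and> eps_optimal ?M ?s (MP_liminf_nonneg ?M ?s) \<epsilon> \<sigma>)"
    if "\<epsilon> < 1" for b \<epsilon> \<sigma>
    using prob_k_bit_Markov_strategy[OF div, of b \<sigma>] val_1 that by (auto simp: eps_optimal_def)
  then show ?thesis
    using is_mdp_game initial_game finitely_branching_game acyclic_game integer_rewards_game
      step_counter_implicit_game val_1 prob_FR_strategy[OF div]
    by (intro exI[of _ ?M] exI[of _ ?s]) simp
qed

end
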